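(* The random vector $g$ and the random matrices $H^{(1,1)}$, $H^{(1,2)}$ are mutually independent; in particular $g$ is independent of $H^{(1,1)}$, $g$ is independent of $H^{(1,2)}$, and $H^{(1,1)}$ is independent of $H^{(1,2)}$.
   Context: Let $D\ge 1$ and write points of $\mathbb{R}^D\times\mathbb{R}^D$ as $x=(x^{(1)},x^{(2)})$, with $x^{flip}=(x^{(2)},x^{(1)})$. A real-valued random field is Gaussian if every finite linear combination of its values is a (possibly degenerate) Gaussian random variable. Let $u$ be a mean-zero isotropic Gaussian field on $\mathbb{R}^D\times\mathbb{R}^D$ with covariance function $k_u(x,y)=h(\|x-y\|_2^2)$, where $h:[0,\infty)\to\mathbb{R}$. The field $f(x)=u(x)-u(x^{flip})$ is called a block isotropic Gaussian field with base field $u$; its covariance function is denoted $k_f$. Standing smoothness assumption: $k_u$ (hence $k_f$) is four times continuously differentiable, and $h$ is twice continuously differentiable on $[0,\infty)$. Derivatives of $f$ are taken in the mean-square ($L^2(\Omega)$) sense. Fix $z^*\in\mathbb{R}^D$ and $z=(z^*,z^* )$. Define the random vector $g\in\mathbb{R}^D$ and random matrices $H^{(1,1)},H^{(1,2)}\in\mathbb{R}^{D\times D}$ by $$g_i=\partial_{x^{(1)}_i}f(x)\big|_{x=z},\quad H^{(1,1)}_{i,j}=\partial_{x^{(1)}_i}\partial_{x^{(1)}_j}f(x)\big|_{x=z},\quad H^{(1,2)}_{i,j}=\partial_{x^{(1)}_i}\partial_{x^{(2)}_j}f(x)\big|_{x=z}.$$ *)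

theory Defs
  imports "HOL-Probability.Probability"
begin

section \<open>Gaussian random fields\<close>

text \<open>A random field on \<open>'p\<close> is a map \<open>'p \<Rightarrow> 'a \<Rightarrow> real\<close>, the value at a point
  being a random variable on the sample space \<open>M\<close>.\<close>

definition gaussian_rv :: "'a measure \<Rightarrow> ('a \<Rightarrow> real) \<Rightarrow> bool" where
  "gaussian_rv M X \<longleftrightarrow> X \<in> borel_measurable M \<and>
     ((\<exists>\<mu> \<sigma>. \<sigma> > 0 \<and> distributed M lborel X (normal_density \<mu> \<sigma>)) \<or>
      (\<exists>\<mu>. AE \<omega> in M. X \<omega> = \<mu>))"

definition gaussian_field :: "'a measure \<Rightarrow> ('p \<Rightarrow> 'a \<Rightarrow> real) \<Rightarrow> bool" where
  "gaussian_field M u \<longleftrightarrow>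
     (\<forall>S c. finite S \<longrightarrow> gaussian_rv M (\<lambda>\<omega>. \<Sum>x\<in>S. c x * u x \<omega>))"

definition cov_fun :: "'a measure \<Rightarrow> ('p \<Rightarrow> 'a \<Rightarrow> real) \<Rightarrow> 'p \<Rightarrow> 'p \<Rightarrow> real" where
  "cov_fun M u x y =
     (\<integral>\<omega>. (u x \<omega> - (\<integral>\<eta>. u x \<eta> \<partial>M)) * (u y \<omega> - (\<integral>\<eta>. u y \<eta> \<partial>M)) \<partial>M)"

text \<open>Only the values of \<open>h\<close> on \<open>[0,\<infinity>)\<close> matter.\<close>

definition isotropic_gaussian_field ::
  "'a measure \<Rightarrow> (real \<Rightarrow> real) \<Rightarrow> ('p::real_normed_vector \<Rightarrow> 'a \<Rightarrow> real) \<Rightarrow> bool" where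
  "isotropic_gaussian_field M h u \<longleftrightarrow>
     gaussian_field M u \<and> (\<forall>x. (\<integral>\<omega>. u x \<omega> \<partial>M) = 0) \<and>
     (\<forall>x y. cov_fun M u x y = h ((norm (x - y))\<^sup>2))"

text \<open>The norm on \<open>(real ^ 'n) \<times> (real ^ 'n)\<close> is the Euclidean one, and
  \<^const>\<open>prod.swap\<close> is the flip.\<close>

definition block_field ::
  "((real ^ 'n) \<times> (real ^ 'n) \<Rightarrow> 'a \<Rightarrow> real) \<Rightarrow> (real ^ 'n) \<times> (real ^ 'n) \<Rightarrow> 'a \<Rightarrow> real" where
  "block_field u x \<omega> = u x \<omega> - u (prod.swap x) \<omega>"


section \<open>Smoothness\<close>

fun Ck :: "nat \<Rightarrow> ('p::euclidean_space \<Rightarrow> real) \<Rightarrow> bool" where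
  "Ck 0 f \<longleftrightarrow> continuous_on UNIV f"
| "Ck (Suc n) f \<longleftrightarrow>
     (\<exists>f'. (\<forall>x. (f has_derivative f' x) (at x)) \<and> (\<forall>v. Ck n (\<lambda>x. f' x v)))"

text \<open>At the endpoint \<open>0\<close> the derivatives are one-sided.\<close>

definition C2_half_line :: "(real \<Rightarrow> real) \<Rightarrow> bool" where
  "C2_half_line h \<longleftrightarrow> (\<exists>h' h''.
     (\<forall>t\<ge>0. (h has_real_derivative h' t) (at t within {0..})) \<and>
     (\<forall>t\<ge>0. (h' has_real_derivative h'' t) (at t within {0..})) \<and>
     continuous_on {0..} h'')"


section \<open>Mean-square derivatives\<close>

text \<open>A mean-square derivative is determined only up to almost sure equality, hence the
  relational form: \<open>Y\<close> is a version of the derivative of \<open>f\<close> at \<open>x\<close> in direction \<open>v\<close>.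
  The nonnegative integral avoids the convention that a non-integrable function has
  Bochner integral \<open>0\<close>.\<close>

definition has_ms_deriv ::
  "'a measure \<Rightarrow> ('p::real_normed_vector \<Rightarrow> 'a \<Rightarrow> real) \<Rightarrow> 'p \<Rightarrow> 'p \<Rightarrow> ('a \<Rightarrow> real) \<Rightarrow> bool" where
  "has_ms_deriv M f v x Y \<longleftrightarrow>
     Y \<in> borel_measurable M \<and> integrable M (\<lambda>\<omega>. (Y \<omega>)\<^sup>2) \<and>
     ((\<lambda>t. \<integral>\<^sup>+\<omega>. ennreal (((f (x + t *\<^sub>R v) \<omega> - f x \<omega>) / t - Y \<omega>)\<^sup>2) \<partial>M) \<longlongrightarrow> 0) (at 0)"

text \<open>The fields \<open>F1 j\<close> and \<open>F2 j\<close> are the first derivatives in the \<open>j\<close>-th coordinate of the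
  first and of the second block; \<open>H11\<close> and \<open>H12\<close> are obtained by differentiating them at
  \<open>z\<close> in the coordinates of the first block.\<close>

definition block_derivatives ::
  "'a measure \<Rightarrow> ((real ^ 'n) \<times> (real ^ 'n) \<Rightarrow> 'a \<Rightarrow> real) \<Rightarrow> (real ^ 'n) \<times> (real ^ 'n) \<Rightarrow>
   ('a \<Rightarrow> real ^ 'n) \<Rightarrow> ('a \<Rightarrow> real ^ 'n ^ 'n) \<Rightarrow> ('a \<Rightarrow> real ^ 'n ^ 'n) \<Rightarrow> bool" where
  "block_derivatives M f z g H11 H12 \<longleftrightarrow> (\<exists>F1 F2.
     (\<forall>j x. has_ms_deriv M f (axis j 1, 0) x (F1 j x)) \<and>
     (\<forall>j x. has_ms_deriv M f (0, axis j 1) x (F2 j x)) \<and>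
     (\<forall>i. has_ms_deriv M f (axis i 1, 0) z (\<lambda>\<omega>. g \<omega> $ i)) \<and>
     (\<forall>i j. has_ms_deriv M (F1 j) (axis i 1, 0) z (\<lambda>\<omega>. H11 \<omega> $ i $ j)) \<and>
     (\<forall>i j. has_ms_deriv M (F2 j) (axis i 1, 0) z (\<lambda>\<omega>. H12 \<omega> $ i $ j)))"


section \<open>Independence of random variables with different value types\<close>

text \<open>The library's \<^const>\<open>prob_space.indep_vars\<close> and \<^const>\<open>prob_space.indep_var\<close> need a common
  value type. The definitions below are what these constants unfold to, with borel
  target spaces.\<close>

definition rv_events :: "'a measure \<Rightarrow> ('a \<Rightarrow> 'b::topological_space) \<Rightarrow> 'a set set" where
  "rv_events M X = {X -` A \<inter> space M | A. A \<in> sets borel}"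

definition indep_rv2 ::
  "'a measure \<Rightarrow> ('a \<Rightarrow> 'b::topological_space) \<Rightarrow> ('a \<Rightarrow> 'c::topological_space) \<Rightarrow> bool" where
  "indep_rv2 M X Y \<longleftrightarrow>
     X \<in> borel_measurable M \<and> Y \<in> borel_measurable M \<and>
     prob_space.indep_set M (rv_events M X) (rv_events M Y)"

definition indep_rv3 ::
  "'a measure \<Rightarrow> ('a \<Rightarrow> 'b::topological_space) \<Rightarrow> ('a \<Rightarrow> 'c::topological_space) \<Rightarrow>
   ('a \<Rightarrow> 'd::topological_space) \<Rightarrow> bool" where
  "indep_rv3 M X Y Z \<longleftrightarrow>
     X \<in> borel_measurable M \<and> Y \<in> borel_measurable M \<and> Z \<in> borel_measurable M \<and>
     prob_space.indep_sets M (\<lambda>i. [rv_events M X, rv_events M Y, rv_events M Z] ! i) {..<3}"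

end

theory Submission
  imports Defs
begin

text \<open>
  Why the theorem holds. A mean-square derivative of the Gaussian field \<open>u\<close> is an \<open>L\<^sup>2\<close>-limit of
  linear combinations of values of \<open>u\<close>, and on the closed span of these values every random
  variable \<open>Y\<close> has the characteristic function of a centered Gaussian, \<open>E exp (iY) = exp (- E Y\<^sup>2 / 2)\<close>.
  Two random vectors with coordinates in this span therefore have a factorizing joint
  characteristic function, and are independent, as soon as they are uncorrelated
  (\<open>indep_rv2_if_char_factorizes\<close>).

  That \<open>g\<close>, \<open>H11\<close> and \<open>H12\<close> are uncorrelated is seen from two symmetries of the base field, without
  computing any covariance. A Euclidean isometry \<open>R\<close> preserves the covariance function of \<open>u\<close>, so
  \<open>u x \<mapsto> u (R x)\<close> extends to an isometry \<open>T\<close> of the closed span, and eigenvectors of \<open>T\<close> for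
  real eigenvalues \<open>a\<close>, \<open>b\<close> with \<open>a * b \<noteq> 1\<close> are orthogonal (\<open>indep_rv2_if_eigenvalues\<close>). Write
  \<open>D v\<close> and \<open>D w (D v)\<close> for the derivatives of \<open>u\<close> at \<open>z = (zs, zs)\<close>, \<open>e1 i\<close> and \<open>e2 i\<close> for the
  unit vectors of the two blocks. Since the flip exchanges \<open>e1 i\<close> with \<open>e2 i\<close> and fixes \<open>z\<close>,

    \<open>g i = D (e1 i) - D (e2 i)\<close>,

    \<open>H11 i j = D (e1 i) (D (e1 j)) - D (e2 i) (D (e2 j))\<close>,

    \<open>H12 i j = D (e1 i) (D (e2 j)) - D (e2 i) (D (e1 j))\<close>.

  Under the point reflection at \<open>z\<close> each derivative contributes a sign, so \<open>g\<close> has eigenvalue \<open>-1\<close>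
  and the second derivatives have eigenvalue \<open>1\<close>: \<open>g\<close> is independent of the pair \<open>(H11, H12)\<close>. Under
  the reflection of the second block only, \<open>H11\<close> has eigenvalue \<open>1\<close>, because each term has an even
  number of derivatives in the second block, and \<open>H12\<close> has eigenvalue \<open>-1\<close>, because each term has
  exactly one. Hence \<open>H11\<close> and \<open>H12\<close> are independent as well. This second reflection does not
  commute with the flip, which is why the argument works with derivatives of \<open>u\<close> instead of the
  block field.

  The derivatives exist because the covariance of difference quotients is a second difference
  quotient of the covariance function; it converges when that function is twice continuously
  differentiable, and its limit is the covariance function of the derivative field
  (\<open>ms_deriv_exists\<close>). Two applications turn \<open>Ck 4\<close> into second derivatives.
\<close>

section \<open>Square integrable random variables\<close>

definition L2 :: "'a measure \<Rightarrow> ('a \<Rightarrow> real) \<Rightarrow> bool" where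
  "L2 M X \<longleftrightarrow> X \<in> borel_measurable M \<and> integrable M (\<lambda>\<omega>. (X \<omega>)\<^sup>2)"

text \<open>Membership of \<open>X t\<close> and \<open>Y\<close> in \<open>L\<^sup>2\<close> is not part of this notion; without it the Bochner
  integrals below may be zero by convention, so it is assumed separately where it matters.\<close>

definition L2_tendsto :: "'a measure \<Rightarrow> ('i \<Rightarrow> 'a \<Rightarrow> real) \<Rightarrow> ('a \<Rightarrow> real) \<Rightarrow> 'i filter \<Rightarrow> bool" where
  "L2_tendsto M X Y F \<longleftrightarrow> ((\<lambda>t. \<integral>\<omega>. (X t \<omega> - Y \<omega>)\<^sup>2 \<partial>M) \<longlongrightarrow> 0) F"

lemma L2_measurable [measurable_dest]: "L2 M X \<Longrightarrow> X \<in> borel_measurable M"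
  by (simp add: L2_def)

lemma L2_integrable_square: "L2 M X \<Longrightarrow> integrable M (\<lambda>\<omega>. (X \<omega>)\<^sup>2)"
  by (simp add: L2_def)

lemma L2_integrable_mult:
  assumes X: "L2 M X" and Y: "L2 M Y"
  shows "integrable M (\<lambda>\<omega>. X \<omega> * Y \<omega>)"
proof (rule Bochner_Integration.integrable_bound)
  show "integrable M (\<lambda>\<omega>. (X \<omega>)\<^sup>2 + (Y \<omega>)\<^sup>2)"
    using assms by (simp add: L2_def)
  show "(\<lambda>\<omega>. X \<omega> * Y \<omega>) \<in> borel_measurable M"
    using assms[THEN L2_measurable] by (rule borel_measurable_times)
  have "\<bar>a * b\<bar> \<le> a\<^sup>2 + b\<^sup>2" for a b :: real
    using zero_le_power2[of "a + b"] zero_le_power2[of "a - b"] zero_le_power2[of a] zero_le_power2[of b]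
    by (simp add: power2_eq_square algebra_simps abs_le_iff) 
  then show "AE \<omega> in M. norm (X \<omega> * Y \<omega>) \<le> norm ((X \<omega>)\<^sup>2 + (Y \<omega>)\<^sup>2)"
    by (intro AE_I2) (metis abs_ge_self order_trans real_norm_def)
qed

lemma L2_scale: "L2 M X \<Longrightarrow> L2 M (\<lambda>\<omega>. a * X \<omega>)"
  by (auto simp: L2_def power_mult_distrib)

lemma L2_add:
  assumes X: "L2 M X" and Y: "L2 M Y"
  shows "L2 M (\<lambda>\<omega>. X \<omega> + Y \<omega>)"
  using assms L2_integrable_mult[OF assms]
  by (auto simp: L2_def power2_sum mult.assoc intro!: Bochner_Integration.integrable_add)

lemma L2_zero: "L2 M (\<lambda>\<omega>. 0)"
  by (simp add: L2_def)

lemma L2_minus: "L2 M X \<Longrightarrow> L2 M (\<lambda>\<omega>. - X \<omega>)"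
  by (simp add: L2_def)

lemma L2_diff: "L2 M X \<Longrightarrow> L2 M Y \<Longrightarrow> L2 M (\<lambda>\<omega>. X \<omega> - Y \<omega>)"
  using L2_add[of M X "\<lambda>\<omega>. - Y \<omega>"] L2_minus[of M Y] by simp

lemma L2_sum: "(\<And>i. i \<in> I \<Longrightarrow> L2 M (X i)) \<Longrightarrow> L2 M (\<lambda>\<omega>. \<Sum>i\<in>I. X i \<omega>)"
  by (induction I rule: infinite_finite_induct) (auto intro: L2_zero L2_add)

lemma L2_divide: "L2 M X \<Longrightarrow> L2 M (\<lambda>\<omega>. X \<omega> / a)"
  using L2_scale[of M X "1 / a"] by simp

text \<open>With \<open>A = E (X Y)\<close>, \<open>B = E Y\<^sup>2\<close> and \<open>C = E X\<^sup>2\<close>, expanding \<open>0 \<le> E (B X - A Y)\<^sup>2\<close> gives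
  \<open>0 \<le> B (C B - A\<^sup>2)\<close>. If \<open>B = 0\<close> then \<open>Y\<close> vanishes almost surely and so does \<open>A\<close>.\<close>

lemma Cauchy_Schwarz_integral:
  assumes X: "L2 M X" and Y: "L2 M Y"
  shows "(\<integral>\<omega>. X \<omega> * Y \<omega> \<partial>M)\<^sup>2 \<le> (\<integral>\<omega>. (X \<omega>)\<^sup>2 \<partial>M) * (\<integral>\<omega>. (Y \<omega>)\<^sup>2 \<partial>M)"
proof -
  define A where "A = (\<integral>\<omega>. X \<omega> * Y \<omega> \<partial>M)"
  define B where "B = (\<integral>\<omega>. (Y \<omega>)\<^sup>2 \<partial>M)"
  define C where "C = (\<integral>\<omega>. (X \<omega>)\<^sup>2 \<partial>M)"
  note [simp] = L2_integrable_square[OF X] L2_integrable_square[OF Y] L2_integrable_mult[OF X Y]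
  have "0 \<le> (\<integral>\<omega>. (B * X \<omega> - A * Y \<omega>)\<^sup>2 \<partial>M)"
    by simp
  also have "\<dots> = (\<integral>\<omega>. B\<^sup>2 * (X \<omega>)\<^sup>2 - 2 * A * B * (X \<omega> * Y \<omega>) + A\<^sup>2 * (Y \<omega>)\<^sup>2 \<partial>M)"
    by (intro Bochner_Integration.integral_cong) (auto simp: power2_eq_square algebra_simps)
  also have "\<dots> = B\<^sup>2 * C - 2 * A * B * A + A\<^sup>2 * B"
    by (simp add: A_def B_def C_def)
  finally have *: "0 \<le> B * (C * B - A\<^sup>2)"
    by (simp add: power2_eq_square algebra_simps)
  have "B \<ge> 0" by (simp add: B_def)
  show ?thesis
  proof (cases "B = 0")
    case True
    then have "AE \<omega> in M. (Y \<omega>)\<^sup>2 = 0"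
      using integral_nonneg_eq_0_iff_AE[of M "\<lambda>\<omega>. (Y \<omega>)\<^sup>2"] by (simp add: B_def)
    then have "A = 0"
      unfolding A_def using L2_measurable[OF X] L2_measurable[OF Y] by (intro integral_eq_zero_AE) auto
    then show ?thesis by (simp add: A_def)
  next
    case False
    with \<open>B \<ge> 0\<close> * have "0 \<le> C * B - A\<^sup>2"
      by (simp add: zero_le_mult_iff)
    then show ?thesis by (simp add: A_def B_def C_def)
  qed
qed

text \<open>A substitute for the triangle inequality that avoids square roots; the constant is harmless in
  limit arguments.\<close>

lemma integral_square_add_le:
  assumes X: "L2 M X" and Y: "L2 M Y"
  shows "(\<integral>\<omega>. (X \<omega> + Y \<omega>)\<^sup>2 \<partial>M) \<le> 2 * (\<integral>\<omega>. (X \<omega>)\<^sup>2 \<partial>M) + 2 * (\<integral>\<omega>. (Y \<omega>)\<^sup>2 \<partial>M)"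
proof -
  have *: "(a + b)\<^sup>2 \<le> 2 * a\<^sup>2 + 2 * b\<^sup>2" for a b :: real
    using zero_le_power2[of "a - b"] by (simp add: power2_eq_square algebra_simps)
  have "(\<integral>\<omega>. (X \<omega> + Y \<omega>)\<^sup>2 \<partial>M) \<le> (\<integral>\<omega>. 2 * (X \<omega>)\<^sup>2 + 2 * (Y \<omega>)\<^sup>2 \<partial>M)"
    using L2_integrable_square[OF L2_add[OF X Y]] L2_integrable_square[OF X] L2_integrable_square[OF Y] *
    by (intro integral_mono) auto
  then show ?thesis
    using L2_integrable_square[OF X] L2_integrable_square[OF Y] by simp
qed

lemma integral_square_triangle:
  assumes "L2 M X" "L2 M Y" "L2 M Z"
  shows "(\<integral>\<omega>. (X \<omega> - Z \<omega>)\<^sup>2 \<partial>M)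
    \<le> 2 * (\<integral>\<omega>. (X \<omega> - Y \<omega>)\<^sup>2 \<partial>M) + 2 * (\<integral>\<omega>. (Y \<omega> - Z \<omega>)\<^sup>2 \<partial>M)"
  using integral_square_add_le[OF L2_diff[OF assms(1,2)] L2_diff[OF assms(2,3)]] by simp

lemma L2_tendsto_add:
  assumes "\<And>t. L2 M (X t)" "\<And>t. L2 M (Y t)" "L2 M X'" "L2 M Y'"
    and "L2_tendsto M X X' F" "L2_tendsto M Y Y' F"
  shows "L2_tendsto M (\<lambda>t \<omega>. X t \<omega> + Y t \<omega>) (\<lambda>\<omega>. X' \<omega> + Y' \<omega>) F"
  unfolding L2_tendsto_def
proof (rule tendsto_sandwich)
  show "\<forall>\<^sub>F t in F. 0 \<le> (\<integral>\<omega>. (X t \<omega> + Y t \<omega> - (X' \<omega> + Y' \<omega>))\<^sup>2 \<partial>M)"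
    by simp
  have "(\<integral>\<omega>. (X t \<omega> + Y t \<omega> - (X' \<omega> + Y' \<omega>))\<^sup>2 \<partial>M)
     \<le> 2 * (\<integral>\<omega>. (X t \<omega> - X' \<omega>)\<^sup>2 \<partial>M) + 2 * (\<integral>\<omega>. (Y t \<omega> - Y' \<omega>)\<^sup>2 \<partial>M)" for t
    using integral_square_add_le[OF L2_diff[OF assms(1,3), of t] L2_diff[OF assms(2,4), of t]]
    by (simp add: algebra_simps)
  then show "\<forall>\<^sub>F t in F. (\<integral>\<omega>. (X t \<omega> + Y t \<omega> - (X' \<omega> + Y' \<omega>))\<^sup>2 \<partial>M)
     \<le> 2 * (\<integral>\<omega>. (X t \<omega> - X' \<omega>)\<^sup>2 \<partial>M) + 2 * (\<integral>\<omega>. (Y t \<omega> - Y' \<omega>)\<^sup>2 \<partial>M)"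
    by simp
  show "((\<lambda>t. 2 * (\<integral>\<omega>. (X t \<omega> - X' \<omega>)\<^sup>2 \<partial>M) + 2 * (\<integral>\<omega>. (Y t \<omega> - Y' \<omega>)\<^sup>2 \<partial>M)) \<longlongrightarrow> 0) F"
    using assms(5,6) unfolding L2_tendsto_def by (auto intro!: tendsto_eq_intros)
qed simp

lemma L2_tendsto_scale:
  assumes "L2_tendsto M X X' F"
  shows "L2_tendsto M (\<lambda>t \<omega>. a * X t \<omega>) (\<lambda>\<omega>. a * X' \<omega>) F"
  using tendsto_mult_right_zero[OF assms[unfolded L2_tendsto_def], of "a\<^sup>2"]
  by (simp add: L2_tendsto_def right_diff_distrib[symmetric] power_mult_distrib)

lemma L2_tendsto_diff:
  assumes "\<And>t. L2 M (X t)" "\<And>t. L2 M (Y t)" "L2 M X'" "L2 M Y'"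
    and "L2_tendsto M X X' F" "L2_tendsto M Y Y' F"
  shows "L2_tendsto M (\<lambda>t \<omega>. X t \<omega> - Y t \<omega>) (\<lambda>\<omega>. X' \<omega> - Y' \<omega>) F"
  using L2_tendsto_add[OF assms(1) L2_scale[OF assms(2)] assms(3) L2_scale[OF assms(4)] assms(5)
      L2_tendsto_scale[OF assms(6)], of "-1"]
  by simp

lemma L2_tendsto_integral_mult:
  assumes X: "\<And>t. L2 M (X t)" and Y: "\<And>t. L2 M (Y t)" and X': "L2 M X'" and Y': "L2 M Y'"
    and lim: "L2_tendsto M X X' F" "L2_tendsto M Y Y' F"
  shows "((\<lambda>t. \<integral>\<omega>. X t \<omega> * Y t \<omega> \<partial>M) \<longlongrightarrow> (\<integral>\<omega>. X' \<omega> * Y' \<omega> \<partial>M)) F"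
proof -
  have CS: "\<bar>\<integral>\<omega>. A \<omega> * B \<omega> \<partial>M\<bar> \<le> sqrt (\<integral>\<omega>. (A \<omega>)\<^sup>2 \<partial>M) * sqrt (\<integral>\<omega>. (B \<omega>)\<^sup>2 \<partial>M)"
    if "L2 M A" "L2 M B" for A B
    using real_sqrt_le_mono[OF Cauchy_Schwarz_integral[OF that]] by (simp add: real_sqrt_mult)
  define a where "a t = sqrt (\<integral>\<omega>. (X t \<omega> - X' \<omega>)\<^sup>2 \<partial>M)" for t
  define b where "b t = sqrt (\<integral>\<omega>. (Y t \<omega> - Y' \<omega>)\<^sup>2 \<partial>M)" for t
  define c where "c = sqrt (\<integral>\<omega>. (X' \<omega>)\<^sup>2 \<partial>M)"
  define d where "d = sqrt (\<integral>\<omega>. (Y' \<omega>)\<^sup>2 \<partial>M)"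
  have lima: "(a \<longlongrightarrow> 0) F" and limb: "(b \<longlongrightarrow> 0) F"
    using lim tendsto_real_sqrt[of _ 0 F] unfolding L2_tendsto_def a_def b_def by fastforce+
  have bound: "\<bar>(\<integral>\<omega>. X t \<omega> * Y t \<omega> \<partial>M) - (\<integral>\<omega>. X' \<omega> * Y' \<omega> \<partial>M)\<bar> \<le> a t * b t + a t * d + c * b t" for t
  proof -
    note D = L2_diff[OF X[of t] X'] L2_diff[OF Y[of t] Y']
    note [simp] = L2_integrable_mult[OF D] L2_integrable_mult[OF D(1) Y'] L2_integrable_mult[OF X' D(2)]
      L2_integrable_mult[OF X Y] L2_integrable_mult[OF X' Y'] 
    have "(\<integral>\<omega>. X t \<omega> * Y t \<omega> \<partial>M) - (\<integral>\<omega>. X' \<omega> * Y' \<omega> \<partial>M)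
      = (\<integral>\<omega>. X t \<omega> * Y t \<omega> - X' \<omega> * Y' \<omega> \<partial>M)"
      by simp
    also have "\<dots> = (\<integral>\<omega>. (X t \<omega> - X' \<omega>) * (Y t \<omega> - Y' \<omega>) + (X t \<omega> - X' \<omega>) * Y' \<omega>
        + X' \<omega> * (Y t \<omega> - Y' \<omega>) \<partial>M)"
      by (intro Bochner_Integration.integral_cong) (auto simp: algebra_simps)
    also have "\<dots> = (\<integral>\<omega>. (X t \<omega> - X' \<omega>) * (Y t \<omega> - Y' \<omega>) \<partial>M)
        + (\<integral>\<omega>. (X t \<omega> - X' \<omega>) * Y' \<omega> \<partial>M) + (\<integral>\<omega>. X' \<omega> * (Y t \<omega> - Y' \<omega>) \<partial>M)"
      by simp
    finally show ?thesis
      using CS[OF D] CS[OF D(1) Y'] CS[OF X' D(2)] unfolding a_def b_def c_def d_def by linarith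
  qed
  have "((\<lambda>t. a t * b t + a t * d + c * b t) \<longlongrightarrow> 0) F"
    using lima limb by (auto intro!: tendsto_eq_intros)
  then have "((\<lambda>t. (\<integral>\<omega>. X t \<omega> * Y t \<omega> \<partial>M) - (\<integral>\<omega>. X' \<omega> * Y' \<omega> \<partial>M)) \<longlongrightarrow> 0) F"
    by (rule Lim_null_comparison[rotated]) (use bound in auto)
  then show ?thesis
    by (simp add: LIM_zero_iff)
qed

lemma L2_tendsto_unique:
  assumes X: "\<And>t. L2 M (X t)" and Y: "L2 M Y" "L2 M Y'"
    and lim: "L2_tendsto M X Y F" "L2_tendsto M X Y' F" and "F \<noteq> bot"
  shows "AE \<omega> in M. Y \<omega> = Y' \<omega>"
proof -
  have "L2_tendsto M (\<lambda>t \<omega>. X t \<omega> - X t \<omega>) (\<lambda>\<omega>. Y \<omega> - Y' \<omega>) F"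
    using X Y lim by (intro L2_tendsto_diff)
  then have "(\<integral>\<omega>. (Y \<omega> - Y' \<omega>)\<^sup>2 \<partial>M) = 0"
    using \<open>F \<noteq> bot\<close> by (simp add: L2_tendsto_def tendsto_const_iff power2_commute)
  then have "AE \<omega> in M. (Y \<omega> - Y' \<omega>)\<^sup>2 = 0"
    using L2_integrable_square[OF L2_diff[OF Y]]
    by (subst integral_nonneg_eq_0_iff_AE[symmetric]) auto
  then show ?thesis by simp
qed

lemma L2_cong_AE:
  assumes "L2 M X" "Y \<in> borel_measurable M" "AE \<omega> in M. X \<omega> = Y \<omega>"
  shows "L2 M Y"
  unfolding L2_def
proof
  have "integrable M (\<lambda>\<omega>. (Y \<omega>)\<^sup>2) \<longleftrightarrow> integrable M (\<lambda>\<omega>. (X \<omega>)\<^sup>2)"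
    using assms L2_measurable[OF assms(1)] by (intro integrable_cong_AE) auto
  then show "integrable M (\<lambda>\<omega>. (Y \<omega>)\<^sup>2)"
    using assms by (simp add: L2_def)
qed fact

lemma nn_integral_square_eq:
  assumes "L2 M X"
  shows "(\<integral>\<^sup>+\<omega>. ennreal ((X \<omega>)\<^sup>2) \<partial>M) = ennreal (\<integral>\<omega>. (X \<omega>)\<^sup>2 \<partial>M)"
  using L2_integrable_square[OF assms] by (intro nn_integral_eq_integral) auto

lemma (in prob_space) L2_const: "L2 M (\<lambda>\<omega>. c)"
  by (simp add: L2_def)

lemma (in prob_space) L2_integrable: "L2 M X \<Longrightarrow> integrable M X"
  using L2_integrable_mult[of M X "\<lambda>\<omega>. 1"] L2_const[of 1] by simp

lemma (in prob_space) integral_abs_le_sqrt: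
  assumes "L2 M X"
  shows "(\<integral>\<omega>. \<bar>X \<omega>\<bar> \<partial>M) \<le> sqrt (\<integral>\<omega>. (X \<omega>)\<^sup>2 \<partial>M)"
proof (rule real_le_rsqrt)
  have "L2 M (\<lambda>\<omega>. \<bar>X \<omega>\<bar>)"
    using assms by (auto simp: L2_def)
  from Cauchy_Schwarz_integral[OF this L2_const[of 1]]
  show "(\<integral>\<omega>. \<bar>X \<omega>\<bar> \<partial>M)\<^sup>2 \<le> (\<integral>\<omega>. (X \<omega>)\<^sup>2 \<partial>M)"
    by (simp add: prob_space)
qed

text \<open>The Riesz-Fischer argument: consecutive differences have summable \<open>L\<^sup>1\<close>-norms, so the sequence
  converges almost surely, and Fatou's lemma transfers the distance estimates to the limit.\<close>

lemma (in prob_space) L2_complete_fast: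
  fixes X :: "nat \<Rightarrow> 'a \<Rightarrow> real"
  assumes X: "\<And>n. L2 M (X n)"
    and fast: "\<And>n m. n \<le> m \<Longrightarrow> (\<integral>\<omega>. (X n \<omega> - X m \<omega>)\<^sup>2 \<partial>M) \<le> (1/4) ^ n"
  shows "\<exists>Y. L2 M Y \<and> (\<forall>n. (\<integral>\<omega>. (X n \<omega> - Y \<omega>)\<^sup>2 \<partial>M) \<le> (1/4) ^ n)"
proof -
  have [measurable]: "X n \<in> borel_measurable M" for n
    using X by (rule L2_measurable)
  define D where "D k \<omega> = \<bar>X k \<omega> - X (Suc k) \<omega>\<bar>" for k \<omega>
  have [measurable]: "D k \<in> borel_measurable M" for k
    unfolding D_def by measurable
  have intD: "integrable M (D k)" for k
    unfolding D_def using L2_integrable[OF L2_diff[OF X X]] by auto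
  have "(\<integral>\<omega>. D k \<omega> \<partial>M) \<le> (1/2) ^ k" for k
  proof -
    have "(\<integral>\<omega>. D k \<omega> \<partial>M) \<le> sqrt ((1/4) ^ k)"
      using integral_abs_le_sqrt[OF L2_diff[OF X X], of k "Suc k"]
        real_sqrt_le_mono[OF fast[of k "Suc k"]] unfolding D_def by linarith
    also have "\<dots> = sqrt (((1/2) ^ k)\<^sup>2)"
      by (simp add: power2_eq_square power_mult_distrib[symmetric])
    finally show ?thesis by simp
  qed
  moreover have "(\<integral>\<^sup>+\<omega>. ennreal (D k \<omega>) \<partial>M) = ennreal (\<integral>\<omega>. D k \<omega> \<partial>M)" for k
    by (rule nn_integral_eq_integral[OF intD]) (simp add: D_def)
  ultimately have "(\<Sum>k. \<integral>\<^sup>+\<omega>. ennreal (D k \<omega>) \<partial>M) \<le> (\<Sum>k. ennreal ((1/2) ^ k))"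
    by (intro suminf_le) (simp_all add: ennreal_leI)
  also have "\<dots> < \<infinity>"
  proof -
    have "(\<Sum>k. ennreal ((1/2) ^ k)) \<noteq> top"
      by (rule ennreal_suminf_neq_top) (auto intro: summable_geometric)
    then show ?thesis
      unfolding infinity_ennreal_def by (rule top.not_eq_extremum[THEN iffD1])
  qed
  finally have "(\<integral>\<^sup>+\<omega>. (\<Sum>k. ennreal (D k \<omega>)) \<partial>M) < \<infinity>"
    by (subst nn_integral_suminf) auto
  then have "AE \<omega> in M. (\<Sum>k. ennreal (D k \<omega>)) \<noteq> \<infinity>"
    by (intro nn_integral_noteq_infinite) auto
  then have conv: "AE \<omega> in M. (\<lambda>n. X n \<omega>) \<longlonglongrightarrow> lim (\<lambda>n. X n \<omega>)"
  proof eventually_elim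
    case (elim \<omega>)
    then have "summable (\<lambda>k. D k \<omega>)"
      by (intro summable_suminf_not_top) (auto simp: D_def)
    then have "summable (\<lambda>k. X k \<omega> - X (Suc k) \<omega>)"
      unfolding D_def by (rule summable_rabs_cancel)
    then obtain l where "(\<lambda>n. \<Sum>k<n. X k \<omega> - X (Suc k) \<omega>) \<longlonglongrightarrow> l"
      by (auto simp: summable_def sums_def)
    then have "(\<lambda>n. X 0 \<omega> - X n \<omega>) \<longlonglongrightarrow> l"
      unfolding sum_lessThan_telescope'[of "\<lambda>k. X k \<omega>"] .
    from tendsto_diff[OF tendsto_const this, of "X 0 \<omega>"]
    have "(\<lambda>n. X n \<omega>) \<longlonglongrightarrow> X 0 \<omega> - l"
      by simp
    then have "convergent (\<lambda>n. X n \<omega>)"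
      by (auto simp: convergent_def)
    then show ?case
      by (simp add: convergent_LIMSEQ_iff)
  qed
  define Y where "Y \<omega> = lim (\<lambda>n. X n \<omega>)" for \<omega>
  have [measurable]: "Y \<in> borel_measurable M"
    unfolding Y_def by measurable
  have nn: "(\<integral>\<^sup>+\<omega>. ennreal ((X n \<omega> - Y \<omega>)\<^sup>2) \<partial>M) \<le> ennreal ((1/4) ^ n)" for n
  proof -
    have "AE \<omega> in M. ennreal ((X n \<omega> - Y \<omega>)\<^sup>2) = liminf (\<lambda>m. ennreal ((X n \<omega> - X m \<omega>)\<^sup>2))"
      using conv
    proof eventually_elim
      case (elim \<omega>)
      have "(\<lambda>m. ennreal ((X n \<omega> - X m \<omega>)\<^sup>2)) \<longlonglongrightarrow> ennreal ((X n \<omega> - Y \<omega>)\<^sup>2)"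
        using elim unfolding Y_def by (intro tendsto_intros tendsto_ennrealI)
      then show ?case
        by (intro lim_imp_Liminf[symmetric]) simp_all
    qed
    then have "(\<integral>\<^sup>+\<omega>. ennreal ((X n \<omega> - Y \<omega>)\<^sup>2) \<partial>M)
        = (\<integral>\<^sup>+\<omega>. liminf (\<lambda>m. ennreal ((X n \<omega> - X m \<omega>)\<^sup>2)) \<partial>M)"
      by (rule nn_integral_cong_AE)
    also have "\<dots> \<le> liminf (\<lambda>m. \<integral>\<^sup>+\<omega>. ennreal ((X n \<omega> - X m \<omega>)\<^sup>2) \<partial>M)"
      by (rule nn_integral_liminf) simp
    also have "\<dots> \<le> ennreal ((1/4) ^ n)"
    proof (rule Liminf_le)
      show "\<forall>\<^sub>F m in sequentially. (\<integral>\<^sup>+\<omega>. ennreal ((X n \<omega> - X m \<omega>)\<^sup>2) \<partial>M) \<le> ennreal ((1/4) ^ n)"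
        using eventually_ge_at_top[of n]
        by eventually_elim (simp add: nn_integral_square_eq[OF L2_diff[OF X X]] fast ennreal_leI)
    qed simp
    finally show ?thesis .
  qed
  have "integrable M (\<lambda>\<omega>. (X n \<omega> - Y \<omega>)\<^sup>2)" for n
    using nn[of n] by (intro integrableI_bounded) (auto intro: le_less_trans)
  then have XY: "L2 M (\<lambda>\<omega>. X n \<omega> - Y \<omega>)" for n
    by (simp add: L2_def)
  have "L2 M Y"
    using L2_diff[OF X XY, of 0 0] by simp
  moreover have "(\<integral>\<omega>. (X n \<omega> - Y \<omega>)\<^sup>2 \<partial>M) \<le> (1/4) ^ n" for n
    using nn[of n] nn_integral_square_eq[OF XY, of n] by simp
  ultimately show ?thesis by blast
qed

text \<open>Completeness for families indexed by real increments: the parameters \<open>s m\<close> shrink fast enough for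
  the preceding lemma to apply to \<open>q (s m)\<close>, and its limit is the limit of the whole family.\<close>

lemma (in prob_space) L2_complete_at_0:
  fixes q :: "real \<Rightarrow> 'a \<Rightarrow> real"
  assumes q: "\<And>t. L2 M (q t)"
    and Cauchy: "\<And>e. e > 0 \<Longrightarrow> \<exists>d>0. \<forall>s t. 0 < \<bar>s\<bar> \<and> \<bar>s\<bar> < d \<and> 0 < \<bar>t\<bar> \<and> \<bar>t\<bar> < d \<longrightarrow>
      (\<integral>\<omega>. (q s \<omega> - q t \<omega>)\<^sup>2 \<partial>M) \<le> e"
  shows "\<exists>Y. L2 M Y \<and> L2_tendsto M q Y (at 0)"
proof -
  have "\<forall>n. \<exists>d>0. \<forall>s t. 0 < \<bar>s\<bar> \<and> \<bar>s\<bar> < d \<and> 0 < \<bar>t\<bar> \<and> \<bar>t\<bar> < d \<longrightarrow>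
      (\<integral>\<omega>. (q s \<omega> - q t \<omega>)\<^sup>2 \<partial>M) \<le> (1/4) ^ n"
    using Cauchy by simp
  from choice[OF this] obtain d where d: "\<And>n::nat. d n > 0"
    and qd: "\<And>n s t. 0 < \<bar>s\<bar> \<Longrightarrow> \<bar>s\<bar> < d n \<Longrightarrow> 0 < \<bar>t\<bar> \<Longrightarrow> \<bar>t\<bar> < d n \<Longrightarrow>
      (\<integral>\<omega>. (q s \<omega> - q t \<omega>)\<^sup>2 \<partial>M) \<le> (1/4) ^ n"
    by blast
  define s where "s m = Min (d ` {..m}) / 2" for m
  have s0: "0 < s m" for m
    using d by (simp add: s_def)
  have sd: "s m < d n" if "n \<le> m" for m n
  proof -
    have "Min (d ` {..m}) \<le> d n"
      using that by (intro Min_le) auto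
    then show ?thesis
      using s0[of m] unfolding s_def by linarith
  qed
  obtain Y where Y: "L2 M Y" and lim: "\<And>n. (\<integral>\<omega>. (q (s n) \<omega> - Y \<omega>)\<^sup>2 \<partial>M) \<le> (1/4) ^ n"
  proof -
    have "(\<integral>\<omega>. (q (s n) \<omega> - q (s m) \<omega>)\<^sup>2 \<partial>M) \<le> (1/4) ^ n" if "n \<le> m" for n m
      using qd[of "s n" n "s m"] s0[of n] s0[of m] sd[OF order_refl, of n] sd[OF that] by simp
    from L2_complete_fast[of "\<lambda>n. q (s n)", OF q this] show ?thesis
      using that by blast
  qed
  have near: "(\<integral>\<omega>. (q t \<omega> - Y \<omega>)\<^sup>2 \<partial>M) \<le> 4 * (1/4) ^ n" if "0 < \<bar>t\<bar>" "\<bar>t\<bar> < d n" for t n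
    using integral_square_triangle[OF q[of t] q[of "s n"] Y] lim[of n] qd[of t n "s n"] s0[of n] sd[of n n] that
    by simp
  have "L2_tendsto M q Y (at 0)"
    unfolding L2_tendsto_def
  proof (rule tendstoI)
    fix e :: real assume "e > 0"
    then obtain n where n: "(1/4::real) ^ n < e / 4"
      using real_arch_pow_inv[of "e/4" "1/4"] by auto
    show "\<forall>\<^sub>F t in at 0. dist (\<integral>\<omega>. (q t \<omega> - Y \<omega>)\<^sup>2 \<partial>M) 0 < e"
      unfolding eventually_at using d[of n] near[of _ n] n
      by (intro exI[of _ "d n"]) (force simp: dist_real_def)
  qed
  with Y show ?thesis by blast
qed

section \<open>Characteristic functions and independence\<close>

context prob_space
begin

text \<open>For the degenerate alternative the mean forces the constant to be \<open>0\<close>, so the formula covers it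
  with variance \<open>0\<close>.\<close>

lemma centered_gaussian_rv:
  assumes G: "gaussian_rv M X" and mean: "(\<integral>\<omega>. X \<omega> \<partial>M) = 0"
  shows "L2 M X" and "(CLINT \<omega>|M. iexp (X \<omega>)) = exp (- (\<integral>\<omega>. (X \<omega>)\<^sup>2 \<partial>M) / 2)"
proof -
  have [measurable]: "X \<in> borel_measurable M"
    using G by (simp add: gaussian_rv_def)
  from G consider \<mu> \<sigma> where "\<sigma> > 0" "distributed M lborel X (normal_density \<mu> \<sigma>)"
    | \<mu> where "AE \<omega> in M. X \<omega> = \<mu>"
    by (auto simp: gaussian_rv_def)
  then have "L2 M X \<and> (CLINT \<omega>|M. iexp (X \<omega>)) = exp (- (\<integral>\<omega>. (X \<omega>)\<^sup>2 \<partial>M) / 2)"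
  proof cases
    case 1
    then have "\<mu> = 0"
      using mean normal_distributed_expectation by simp
    with 1 have D: "distributed M lborel X (normal_density 0 \<sigma>)" by simp
    have "integrable lborel (\<lambda>x. normal_density 0 \<sigma> x * (x - 0)\<^sup>2)"
      using 1 by (intro integrable_normal_moment)
    then have L2: "L2 M X"
      using distributed_integrable[OF D, of "\<lambda>x. x\<^sup>2"] by (simp add: L2_def)
    have var: "(\<integral>\<omega>. (X \<omega>)\<^sup>2 \<partial>M) = \<sigma>\<^sup>2"
      using normal_distributed_variance[OF 1(1) D] mean by simp
    have "distributed M lborel (\<lambda>\<omega>. X \<omega> / \<sigma>) std_normal_density"
      using normal_standard_normal_convert[OF 1(1), of X 0] D by simp
    then have distr: "distr M lborel (\<lambda>\<omega>. X \<omega> / \<sigma>) = std_normal_distribution"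
      by (simp add: distributed_def)
    have "complex_of_real (exp (- (\<sigma>\<^sup>2) / 2)) = char std_normal_distribution \<sigma>"
      by (simp add: char_std_normal_distribution)
    also have "\<dots> = (CLINT \<omega>|M. iexp (\<sigma> * (X \<omega> / \<sigma>)))"
      unfolding char_def distr[symmetric] by (subst integral_distr) auto
    also have "\<dots> = (CLINT \<omega>|M. iexp (X \<omega>))"
      using 1(1) by simp
    finally show ?thesis
      using L2 unfolding var by simp
  next
    case 2
    then have "(\<integral>\<omega>. X \<omega> \<partial>M) = (\<integral>\<omega>. \<mu> \<partial>M)"
      by (intro integral_cong_AE) auto
    with mean have "\<mu> = 0"
      by (simp add: prob_space)
    with 2 have X0: "AE \<omega> in M. X \<omega> = 0" by simp
    have "L2 M X"
    proof (rule L2_cong_AE[OF L2_zero])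
      show "AE \<omega> in M. 0 = X \<omega>"
        using X0 by eventually_elim simp
    qed simp
    moreover have "(CLINT \<omega>|M. iexp (X \<omega>)) = (CLINT \<omega>|M. 1)"
      using X0 by (intro integral_cong_AE) auto
    moreover have "(\<integral>\<omega>. (X \<omega>)\<^sup>2 \<partial>M) = (\<integral>\<omega>. 0 \<partial>M)"
      using X0 by (intro integral_cong_AE) auto
    ultimately show ?thesis
      by (simp add: prob_space)
  qed
  then show "L2 M X" and "(CLINT \<omega>|M. iexp (X \<omega>)) = exp (- (\<integral>\<omega>. (X \<omega>)\<^sup>2 \<partial>M) / 2)"
    by auto
qed

lemma tendsto_integral_iexp:
  assumes X: "\<And>n. L2 M (X n)" and Y: "L2 M Y" and lim: "L2_tendsto M X Y F"
  shows "((\<lambda>n. CLINT \<omega>|M. iexp (X n \<omega>)) \<longlongrightarrow> (CLINT \<omega>|M. iexp (Y \<omega>))) F"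
proof -
  have [measurable]: "X n \<in> borel_measurable M" "Y \<in> borel_measurable M" for n
    using X Y by (auto dest: L2_measurable)
  have int: "integrable M (\<lambda>\<omega>. iexp (Z \<omega>))" if [measurable]: "Z \<in> borel_measurable M" for Z :: "'a \<Rightarrow> real"
    by (rule integrable_const_bound[where B = 1]) auto
  have "norm ((CLINT \<omega>|M. iexp (X n \<omega>)) - (CLINT \<omega>|M. iexp (Y \<omega>)))
      \<le> sqrt (\<integral>\<omega>. (X n \<omega> - Y \<omega>)\<^sup>2 \<partial>M)" for n
  proof -
    have "norm (iexp a - iexp b) \<le> \<bar>a - b\<bar>" for a b
    proof -
      have "iexp a - iexp b = iexp b * (iexp (a - b) - 1)"
        by (simp add: algebra_simps exp_add[symmetric])
      then show ?thesis
        using iexp_approx1[of "a - b" 0] by (simp add: norm_mult)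
    qed
    then have "(\<integral>\<omega>. norm (iexp (X n \<omega>) - iexp (Y \<omega>)) \<partial>M) \<le> (\<integral>\<omega>. \<bar>X n \<omega> - Y \<omega>\<bar> \<partial>M)"
    proof (intro integral_mono)
      show "integrable M (\<lambda>\<omega>. norm (iexp (X n \<omega>) - iexp (Y \<omega>)))"
        by (intro integrable_norm Bochner_Integration.integrable_diff int) auto
      show "integrable M (\<lambda>\<omega>. \<bar>X n \<omega> - Y \<omega>\<bar>)"
        by (intro integrable_abs L2_integrable L2_diff X Y)
    qed auto
    also have "\<dots> \<le> sqrt (\<integral>\<omega>. (X n \<omega> - Y \<omega>)\<^sup>2 \<partial>M)"
      by (rule integral_abs_le_sqrt[OF L2_diff[OF X Y]])
    finally have "(\<integral>\<omega>. norm (iexp (X n \<omega>) - iexp (Y \<omega>)) \<partial>M) \<le> sqrt (\<integral>\<omega>. (X n \<omega> - Y \<omega>)\<^sup>2 \<partial>M)" .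
    moreover have "(CLINT \<omega>|M. iexp (X n \<omega>)) - (CLINT \<omega>|M. iexp (Y \<omega>))
        = (CLINT \<omega>|M. iexp (X n \<omega>) - iexp (Y \<omega>))"
      by (intro Bochner_Integration.integral_diff[symmetric] int) auto
    ultimately show ?thesis
      using integral_norm_bound[of M "\<lambda>\<omega>. iexp (X n \<omega>) - iexp (Y \<omega>)"] by (simp only:)
  qed
  moreover have "((\<lambda>n. sqrt (\<integral>\<omega>. (X n \<omega> - Y \<omega>)\<^sup>2 \<partial>M)) \<longlongrightarrow> 0) F"
    using tendsto_real_sqrt[OF lim[unfolded L2_tendsto_def]] by simp
  ultimately have "((\<lambda>n. (CLINT \<omega>|M. iexp (X n \<omega>)) - (CLINT \<omega>|M. iexp (Y \<omega>))) \<longlongrightarrow> 0) F"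
    by (auto intro: Lim_null_comparison[rotated])
  then show ?thesis
    by (simp add: LIM_zero_iff)
qed

lemma integrable_bounded_complex:
  fixes f :: "'a \<Rightarrow> complex"
  assumes "f \<in> borel_measurable M" "\<And>\<omega>. norm (f \<omega>) \<le> B"
  shows "integrable M f"
  using assms by (intro integrable_const_bound[where B = B]) auto

text \<open>Levy's uniqueness theorem with a signed weight \<open>W\<close>. After scaling and adding \<open>1\<close> the weight becomes
  a probability density \<open>D\<close>, under which \<open>X\<close> has the same characteristic function as under \<open>M\<close>;
  hence \<open>X\<close> has the same law, and subtracting the two laws leaves the contribution of \<open>W\<close>.\<close>

lemma orthogonal_characters_imp_orthogonal_events_real:
  fixes W X :: "'a \<Rightarrow> real"
  assumes [measurable]: "W \<in> borel_measurable M" "X \<in> borel_measurable M" "A \<in> sets borel"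
    and bound: "\<And>\<omega>. \<bar>W \<omega>\<bar> \<le> c"
    and orth: "\<And>s. (CLINT \<omega>|M. complex_of_real (W \<omega>) * iexp (s * X \<omega>)) = 0"
  shows "(\<integral>\<omega>. W \<omega> * indicator A (X \<omega>) \<partial>M) = 0"
proof -
  \<comment> \<open>The summand 1 keeps the divisor positive even for c = 0.\<close>
  define C where "C = c + 1"
  have c0: "0 \<le> c" using bound[of undefined] by linarith
  have C0: "0 < C" using c0 by (simp add: C_def)
  define D where "D \<omega> = 1 + W \<omega> / C" for \<omega>
  have [measurable]: "D \<in> borel_measurable M"
    unfolding D_def by measurable
  have D0: "0 \<le> D \<omega>" for \<omega>
    using bound[of \<omega>] C0 by (simp add: D_def C_def field_simps)
  have intW: "integrable M W"
    using bound by (intro integrable_const_bound[where B = c]) auto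
  then have intD: "integrable M D"
    unfolding D_def by simp
  have "(\<integral>\<omega>. W \<omega> \<partial>M) = 0"
    using orth[of 0] by simp
  then have D1: "(\<integral>\<omega>. D \<omega> \<partial>M) = 1"
    unfolding D_def using intW by (simp add: prob_space)
  define N where "N = density M D"
  have sets_N [measurable_cong]: "sets N = sets M"
    by (simp add: N_def)
  have emeasure_N: "emeasure N B = ennreal (\<integral>\<omega>. D \<omega> * indicator B \<omega> \<partial>M)" if [measurable]: "B \<in> sets M" for B
  proof -
    have "emeasure N B = (\<integral>\<^sup>+\<omega>. ennreal (D \<omega> * indicator B \<omega>) \<partial>M)"
      unfolding N_def by (subst emeasure_density) (auto intro!: nn_integral_cong split: split_indicator)
    also have "\<dots> = ennreal (\<integral>\<omega>. D \<omega> * indicator B \<omega> \<partial>M)"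
      using D0 intD by (intro nn_integral_eq_integral integrable_real_mult_indicator) auto
    finally show ?thesis .
  qed
  have "prob_space N"
  proof
    have "(\<integral>\<omega>. D \<omega> * indicator (space M) \<omega> \<partial>M) = (\<integral>\<omega>. D \<omega> \<partial>M)"
      by (intro Bochner_Integration.integral_cong) auto
    then show "emeasure N (space N) = 1"
      using emeasure_N[of "space M"] D1 by (simp add: N_def)
  qed
  then interpret N: prob_space N .
  have "real_distribution (distr N borel X)" "real_distribution (distr M borel X)"
    by (auto intro!: N.real_distribution_distr real_distribution_distr)
  moreover have "char (distr N borel X) = char (distr M borel X)"
  proof
    fix s
    have int: "integrable M (\<lambda>\<omega>. complex_of_real (W \<omega>) * iexp (s * X \<omega>))"
      using bound by (intro integrable_bounded_complex[where B = c]) (auto simp: norm_mult)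
    have int': "integrable M (\<lambda>\<omega>. iexp (s * X \<omega>))"
      by (intro integrable_bounded_complex[where B = 1]) auto
    have "char (distr N borel X) s = (CLINT \<omega>|N. iexp (s * X \<omega>))"
      unfolding char_def by (subst integral_distr) auto
    also have "\<dots> = (CLINT \<omega>|M. D \<omega> *\<^sub>R iexp (s * X \<omega>))"
      unfolding N_def using D0 by (subst integral_density) auto
    also have "\<dots> = (CLINT \<omega>|M. iexp (s * X \<omega>) + (complex_of_real (W \<omega>) * iexp (s * X \<omega>)) / C)"
      using C0 by (intro Bochner_Integration.integral_cong) (auto simp: D_def scaleR_conv_of_real field_simps)
    also have "\<dots> = (CLINT \<omega>|M. iexp (s * X \<omega>)) + (CLINT \<omega>|M. complex_of_real (W \<omega>) * iexp (s * X \<omega>)) / C"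
      using int int' by (subst Bochner_Integration.integral_add) auto
    also have "\<dots> = char (distr M borel X) s"
      using orth[of s] unfolding char_def by (subst integral_distr) auto
    finally show "char (distr N borel X) s = char (distr M borel X) s" .
  qed
  ultimately have eq: "distr N borel X = distr M borel X"
    by (rule Levy_uniqueness)
  let ?B = "X -` A \<inter> space M"
  have "emeasure N ?B = emeasure (distr N borel X) A"
    by (subst emeasure_distr) (auto simp: N_def)
  also have "\<dots> = emeasure M ?B"
    unfolding eq by (subst emeasure_distr) auto
  finally have "ennreal (\<integral>\<omega>. D \<omega> * indicator ?B \<omega> \<partial>M) = ennreal (prob ?B)"
    by (simp add: emeasure_N emeasure_eq_measure)
  then have "(\<integral>\<omega>. D \<omega> * indicator ?B \<omega> \<partial>M) = prob ?B"
    using D0 by (subst (asm) ennreal_inj) (auto intro!: integral_nonneg_AE)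
  moreover have "(\<integral>\<omega>. D \<omega> * indicator ?B \<omega> \<partial>M)
      = (\<integral>\<omega>. indicator ?B \<omega> + (W \<omega> * indicator A (X \<omega>)) / C \<partial>M)"
    using C0 by (intro Bochner_Integration.integral_cong) (auto simp: D_def field_simps split: split_indicator)
  moreover have "\<dots> = prob ?B + (\<integral>\<omega>. W \<omega> * indicator A (X \<omega>) \<partial>M) / C"
  proof -
    have "integrable M (\<lambda>\<omega>. W \<omega> * indicator A (X \<omega>))"
      using bound c0 by (intro integrable_const_bound[where B = c]) (auto split: split_indicator)
    moreover have "integrable M (indicator ?B :: _ \<Rightarrow> real)"
      by (intro integrable_const_bound[where B = 1]) auto
    ultimately show ?thesis
      by simp
  qed
  ultimately show ?thesis
    using C0 by simp
qed

text \<open>Apply the real case to the real and imaginary parts of \<open>W\<close>. They inherit the hypothesis because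
  it also holds for the conjugate of \<open>W\<close>, by replacing \<open>s\<close> with \<open>- s\<close>.\<close>

lemma orthogonal_characters_imp_orthogonal_events:
  fixes W :: "'a \<Rightarrow> complex" and X :: "'a \<Rightarrow> real"
  assumes [measurable]: "W \<in> borel_measurable M" "X \<in> borel_measurable M" "A \<in> sets borel"
    and bound: "\<And>\<omega>. norm (W \<omega>) \<le> c"
    and orth: "\<And>s. (CLINT \<omega>|M. W \<omega> * iexp (s * X \<omega>)) = 0"
  shows "(CLINT \<omega>|M. W \<omega> * indicator A (X \<omega>)) = 0"
proof -
  have c0: "0 \<le> c" using bound[of undefined] norm_ge_zero order_trans by blast
  have [measurable]: "(\<lambda>\<omega>. cnj (W \<omega>)) \<in> borel_measurable M"
    by (rule borel_measurable_continuous_on[OF _ assms(1)]) (intro continuous_intros)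
  have int: "integrable M (\<lambda>\<omega>. W \<omega> * iexp (s * X \<omega>))" for s
    using bound by (intro integrable_bounded_complex[where B = c]) (auto simp: norm_mult)
  have int': "integrable M (\<lambda>\<omega>. cnj (W \<omega>) * iexp (s * X \<omega>))" for s
    using bound by (intro integrable_bounded_complex[where B = c]) (auto simp: norm_mult)
  have orth': "(CLINT \<omega>|M. cnj (W \<omega>) * iexp (s * X \<omega>)) = 0" for s
  proof -
    have "(CLINT \<omega>|M. cnj (W \<omega>) * iexp (s * X \<omega>)) = (CLINT \<omega>|M. cnj (W \<omega> * iexp ((- s) * X \<omega>)))"
      by (intro Bochner_Integration.integral_cong) (auto simp: exp_cnj)
    also have "\<dots> = cnj (CLINT \<omega>|M. W \<omega> * iexp ((- s) * X \<omega>))"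
      by (rule Bochner_Integration.integral_cnj)
    finally show ?thesis using orth[of "- s"] by simp
  qed
  have "(\<integral>\<omega>. Re (W \<omega>) * indicator A (X \<omega>) \<partial>M) = 0"
  proof (rule orthogonal_characters_imp_orthogonal_events_real)
    show "\<bar>Re (W \<omega>)\<bar> \<le> c" for \<omega>
      using abs_Re_le_cmod[of "W \<omega>"] bound[of \<omega>] by linarith
    show "(CLINT \<omega>|M. complex_of_real (Re (W \<omega>)) * iexp (s * X \<omega>)) = 0" for s
    proof -
      have "(CLINT \<omega>|M. complex_of_real (Re (W \<omega>)) * iexp (s * X \<omega>))
        = (CLINT \<omega>|M. (W \<omega> * iexp (s * X \<omega>)) / 2 + (cnj (W \<omega>) * iexp (s * X \<omega>)) / 2)"
        by (intro Bochner_Integration.integral_cong refl)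
          (simp add: complex_add_cnj[symmetric] flip: distrib_right add_divide_distrib, simp add: complex_add_cnj)
      then show ?thesis
        using int[of s] int'[of s] orth[of s] orth'[of s]
        by (subst (asm) Bochner_Integration.integral_add) auto
    qed
  qed auto
  moreover have "(\<integral>\<omega>. Im (W \<omega>) * indicator A (X \<omega>) \<partial>M) = 0"
  proof (rule orthogonal_characters_imp_orthogonal_events_real)
    show "\<bar>Im (W \<omega>)\<bar> \<le> c" for \<omega>
      using abs_Im_le_cmod[of "W \<omega>"] bound[of \<omega>] by linarith
    show "(CLINT \<omega>|M. complex_of_real (Im (W \<omega>)) * iexp (s * X \<omega>)) = 0" for s
    proof -
      have "complex_of_real (Im w) = (w - cnj w) / (2 * \<i>)" for w
        by (simp add: complex_eq_iff)
      then have "(CLINT \<omega>|M. complex_of_real (Im (W \<omega>)) * iexp (s * X \<omega>))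
        = (CLINT \<omega>|M. (W \<omega> * iexp (s * X \<omega>)) / (2 * \<i>) - (cnj (W \<omega>) * iexp (s * X \<omega>)) / (2 * \<i>))"
        by (intro Bochner_Integration.integral_cong refl) (simp only: left_diff_distrib diff_divide_distrib times_divide_eq_left)
      then show ?thesis
        using int[of s] int'[of s] orth[of s] orth'[of s]
        by (subst (asm) Bochner_Integration.integral_diff) auto
    qed
  qed auto
  moreover have "integrable M (\<lambda>\<omega>. W \<omega> * indicator A (X \<omega>))"
    using bound c0 by (intro integrable_bounded_complex[where B = c]) (auto simp: norm_mult split: split_indicator)
  moreover have "Re (W \<omega> * indicator A (X \<omega>)) = Re (W \<omega>) * indicator A (X \<omega>)"
    "Im (W \<omega> * indicator A (X \<omega>)) = Im (W \<omega>) * indicator A (X \<omega>)" for \<omega>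
    by (auto split: split_indicator)
  ultimately show ?thesis
    by (simp add: complex_eq_iff flip: integral_Re integral_Im)
qed

text \<open>The multivariate version follows one coordinate at a time: the characters of the remaining
  coordinates are absorbed into the weight, the one-dimensional lemma replaces the character of the
  current coordinate by an indicator, and this indicator is then absorbed into the weight instead.
  Allowing a complex weight is what makes this induction possible.\<close>

lemma orthogonal_characters_imp_orthogonal_rectangles:
  fixes W :: "'a \<Rightarrow> complex" and X :: "'i \<Rightarrow> 'a \<Rightarrow> real"
  assumes "finite J"
    and "\<And>j. j \<in> J \<Longrightarrow> X j \<in> borel_measurable M" "\<And>j. j \<in> J \<Longrightarrow> A j \<in> sets borel"
    and "W \<in> borel_measurable M" "\<And>\<omega>. norm (W \<omega>) \<le> c"
    and "\<And>s. (CLINT \<omega>|M. W \<omega> * iexp (\<Sum>j\<in>J. s j * X j \<omega>)) = 0"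
  shows "(CLINT \<omega>|M. W \<omega> * (\<Prod>j\<in>J. indicator (A j) (X j \<omega>))) = 0"
  using assms
proof (induction J arbitrary: W rule: finite_induct)
  case empty
  then show ?case by simp
next
  case (insert j J)
  note [measurable] = insert.prems(1-3)
  have c0: "0 \<le> c" using insert.prems(4)[of undefined] norm_ge_zero order_trans by blast
  have [measurable]: "(\<lambda>\<omega>. \<Sum>i\<in>J. s i * X i \<omega>) \<in> borel_measurable M" for s
    using insert.prems(1) by (intro borel_measurable_sum borel_measurable_times) auto
  have "(CLINT \<omega>|M. (W \<omega> * indicator (A j) (X j \<omega>)) * (\<Prod>i\<in>J. indicator (A i) (X i \<omega>))) = 0"
  proof (rule insert.IH)
    show "(\<lambda>\<omega>. W \<omega> * indicator (A j) (X j \<omega>)) \<in> borel_measurable M"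
      by measurable
    show "norm (W \<omega> * indicator (A j) (X j \<omega>)) \<le> c" for \<omega>
      using insert.prems(4)[of \<omega>] c0 by (auto split: split_indicator)
    show "(CLINT \<omega>|M. W \<omega> * indicator (A j) (X j \<omega>) * iexp (\<Sum>i\<in>J. s i * X i \<omega>)) = 0" for s
    proof -
      have "(CLINT \<omega>|M. (W \<omega> * iexp (\<Sum>i\<in>J. s i * X i \<omega>)) * indicator (A j) (X j \<omega>)) = 0"
      proof (rule orthogonal_characters_imp_orthogonal_events[where c = c])
        show "norm (W \<omega> * iexp (\<Sum>i\<in>J. s i * X i \<omega>)) \<le> c" for \<omega>
          using insert.prems(4)[of \<omega>] by (simp add: norm_mult)
        fix r
        have "(\<Sum>i\<in>insert j J. (s(j := r)) i * X i \<omega>) = r * X j \<omega> + (\<Sum>i\<in>J. s i * X i \<omega>)" for \<omega>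
        proof -
          have "(\<Sum>i\<in>J. (s(j := r)) i * X i \<omega>) = (\<Sum>i\<in>J. s i * X i \<omega>)"
            using insert.hyps by (intro sum.cong) auto
          then show ?thesis
            using insert.hyps by simp
        qed
        then show "(CLINT \<omega>|M. W \<omega> * iexp (\<Sum>i\<in>J. s i * X i \<omega>) * iexp (r * X j \<omega>)) = 0"
          using insert.prems(5)[of "s(j := r)"]
          by (simp only: mult.assoc exp_add[symmetric] of_real_add distrib_left add.commute)
      qed auto
      then show ?thesis
        by (simp add: mult_ac)
    qed
  qed (use insert.prems in auto)
  then show ?case
    using insert.hyps by (simp add: mult.assoc)
qed

lemma orthogonal_characters_imp_orthogonal_boxes:
  fixes W :: "'a \<Rightarrow> complex" and X :: "'a \<Rightarrow> 'b :: euclidean_space"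
  assumes [measurable]: "W \<in> borel_measurable M" "X \<in> borel_measurable M"
    and bound: "\<And>\<omega>. norm (W \<omega>) \<le> c"
    and orth: "\<And>s. (CLINT \<omega>|M. W \<omega> * iexp (s \<bullet> X \<omega>)) = 0"
  shows "(CLINT \<omega>|M. W \<omega> * indicator (box a b) (X \<omega>)) = 0"
proof -
  have "indicator (box a b) x = (\<Prod>j\<in>Basis. indicator {a \<bullet> j<..<b \<bullet> j} (x \<bullet> j) :: complex)" for x
  proof (cases "x \<in> box a b")
    case True
    then show ?thesis
      by (auto simp: mem_box intro!: prod.neutral[symmetric])
  next
    case False
    then obtain j where "j \<in> Basis" "x \<bullet> j \<notin> {a \<bullet> j<..<b \<bullet> j}"
      by (auto simp: mem_box)
    then have "\<exists>j\<in>Basis. indicator {a \<bullet> j<..<b \<bullet> j} (x \<bullet> j) = (0 :: complex)"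
      by (metis indicator_simps(2))
    then have "(\<Prod>j\<in>Basis. indicator {a \<bullet> j<..<b \<bullet> j} (x \<bullet> j)) = (0 :: complex)"
      by (intro prod_zero) auto
    with False show ?thesis
      by simp
  qed
  moreover have "(CLINT \<omega>|M. W \<omega> * (\<Prod>j\<in>Basis. indicator {a \<bullet> j<..<b \<bullet> j} (X \<omega> \<bullet> j))) = 0"
  proof (rule orthogonal_characters_imp_orthogonal_rectangles[where c = c])
    show "(CLINT \<omega>|M. W \<omega> * iexp (\<Sum>j\<in>Basis. s j * (X \<omega> \<bullet> j))) = 0" for s
    proof -
      have "(\<Sum>j\<in>Basis. s j * (X \<omega> \<bullet> j)) = (\<Sum>j\<in>Basis. s j *\<^sub>R j) \<bullet> X \<omega>" for \<omega>
        unfolding inner_sum_left inner_scaleR_left by (simp add: inner_commute)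
      then show ?thesis
        using orth[of "\<Sum>j\<in>Basis. s j *\<^sub>R j"] by simp
    qed
  qed (use bound in auto)
  ultimately show ?thesis by simp
qed

lemma rv_events_eq_sigma_sets_boxes:
  fixes X :: "'a \<Rightarrow> 'b :: euclidean_space"
  shows "rv_events M X = sigma_sets (space M) {X -` box a b \<inter> space M | a b. True}"
proof -
  have "rv_events M X = {X -` A \<inter> space M |A. A \<in> sigma_sets UNIV (range (\<lambda>(a, b). box a b :: 'b set))}"
    unfolding rv_events_def by (subst borel_eq_box) simp
  also have "\<dots> = sigma_sets (space M) {X -` A \<inter> space M |A. A \<in> range (\<lambda>(a, b). box a b :: 'b set)}"
    by (rule sigma_sets_vimage_commute) auto
  also have "{X -` A \<inter> space M |A. A \<in> range (\<lambda>(a, b). box a b :: 'b set)} = {X -` box a b \<inter> space M | a b. True}"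
    by auto
  finally show ?thesis .
qed

text \<open>Kac's theorem. The weight \<open>exp (i t\<bullet>Y) - E exp (i t\<bullet>Y)\<close> is orthogonal to the characters of \<open>X\<close>,
  hence to the events \<open>X \<in> box a b\<close>; so the weight \<open>indicator (box a b) X - P (X \<in> box a b)\<close> is
  orthogonal to the characters of \<open>Y\<close>, hence to the events \<open>Y \<in> box c d\<close>. Boxes form an
  intersection-stable generator of the Borel sets.\<close>

theorem indep_rv2_if_char_factorizes:
  fixes X :: "'a \<Rightarrow> 'b :: euclidean_space" and Y :: "'a \<Rightarrow> 'c :: euclidean_space"
  assumes [measurable]: "X \<in> borel_measurable M" "Y \<in> borel_measurable M"
    and char: "\<And>s t. (CLINT \<omega>|M. iexp (s \<bullet> X \<omega> + t \<bullet> Y \<omega>))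
      = (CLINT \<omega>|M. iexp (s \<bullet> X \<omega>)) * (CLINT \<omega>|M. iexp (t \<bullet> Y \<omega>))"
  shows "indep_rv2 M X Y"
proof -
  have box: "prob ((X -` box a b \<inter> space M) \<inter> (Y -` box c d \<inter> space M))
      = prob (X -` box a b \<inter> space M) * prob (Y -` box c d \<inter> space M)" for a b c d
  proof -
    let ?IX = "\<lambda>\<omega>. indicator (box a b) (X \<omega>) :: complex"
    let ?IY = "\<lambda>\<omega>. indicator (box c d) (Y \<omega>) :: complex"
    let ?p = "complex_of_real (prob (X -` box a b \<inter> space M))"
    have ind: "(CLINT \<omega>|M. indicator A (Z \<omega>)) = complex_of_real (prob (Z -` A \<inter> space M))"
      if [measurable]: "Z \<in> borel_measurable M" "A \<in> sets borel"
      for A and Z :: "'a \<Rightarrow> 'd :: euclidean_space"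
    proof -
      have "(CLINT \<omega>|M. indicator A (Z \<omega>)) = (CLINT \<omega>|M. complex_of_real (indicator (Z -` A \<inter> space M) \<omega>))"
        by (intro Bochner_Integration.integral_cong) (auto split: split_indicator)
      then show ?thesis by simp
    qed
    have intI: "integrable M (\<lambda>\<omega>. ?IX \<omega> * iexp (t \<bullet> Y \<omega>))" for t
      by (intro integrable_bounded_complex[where B = 1]) (auto simp: norm_mult split: split_indicator)
    have inte: "integrable M (\<lambda>\<omega>. iexp (t \<bullet> Z \<omega>))" if [measurable]: "Z \<in> borel_measurable M"
      for t and Z :: "'a \<Rightarrow> 'd :: euclidean_space"
      by (intro integrable_bounded_complex[where B = 1]) auto
    have intX: "integrable M ?IX"
      by (intro integrable_bounded_complex[where B = 1]) (auto split: split_indicator)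
    have intY: "integrable M ?IY"
      by (intro integrable_bounded_complex[where B = 1]) (auto split: split_indicator)
    have intXY: "integrable M (\<lambda>\<omega>. ?IX \<omega> * ?IY \<omega>)"
      by (intro integrable_bounded_complex[where B = 1]) (auto split: split_indicator)
    have stepX: "(CLINT \<omega>|M. ?IX \<omega> * iexp (t \<bullet> Y \<omega>)) = ?p * (CLINT \<omega>|M. iexp (t \<bullet> Y \<omega>))" for t
    proof -
      let ?k = "CLINT \<omega>|M. iexp (t \<bullet> Y \<omega>)"
      have "(CLINT \<omega>|M. (iexp (t \<bullet> Y \<omega>) - ?k) * ?IX \<omega>) = 0"
      proof (rule orthogonal_characters_imp_orthogonal_boxes[where c = "1 + norm ?k"])
        show "norm (iexp (t \<bullet> Y \<omega>) - ?k) \<le> 1 + norm ?k" for \<omega>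
          using norm_triangle_ineq4[of "iexp (t \<bullet> Y \<omega>)" ?k] by simp
        fix s
        have "integrable M (\<lambda>\<omega>. iexp (s \<bullet> X \<omega> + t \<bullet> Y \<omega>))"
          by (intro integrable_bounded_complex[where B = 1]) auto
        moreover have "(CLINT \<omega>|M. (iexp (t \<bullet> Y \<omega>) - ?k) * iexp (s \<bullet> X \<omega>))
            = (CLINT \<omega>|M. iexp (s \<bullet> X \<omega> + t \<bullet> Y \<omega>) - ?k * iexp (s \<bullet> X \<omega>))"
          by (intro Bochner_Integration.integral_cong refl)
            (simp add: left_diff_distrib exp_add[symmetric] distrib_left add.commute)
        ultimately show "(CLINT \<omega>|M. (iexp (t \<bullet> Y \<omega>) - ?k) * iexp (s \<bullet> X \<omega>)) = 0"
          using inte[of X s] char[of s t] by (simp add: mult.commute)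
      qed auto
      moreover have "(CLINT \<omega>|M. (iexp (t \<bullet> Y \<omega>) - ?k) * ?IX \<omega>)
          = (CLINT \<omega>|M. ?IX \<omega> * iexp (t \<bullet> Y \<omega>) - ?k * ?IX \<omega>)"
        by (intro Bochner_Integration.integral_cong refl) (simp add: algebra_simps)
      ultimately show ?thesis
        using intI[of t] intX by (simp add: ind mult.commute)
    qed
    have "(CLINT \<omega>|M. (?IX \<omega> - ?p) * ?IY \<omega>) = 0"
    proof (rule orthogonal_characters_imp_orthogonal_boxes[where c = "1 + norm ?p"])
      show "norm (?IX \<omega> - ?p) \<le> 1 + norm ?p" for \<omega>
        using norm_triangle_ineq4[of "?IX \<omega>" ?p] by (auto split: split_indicator)
      fix t
      have "(CLINT \<omega>|M. (?IX \<omega> - ?p) * iexp (t \<bullet> Y \<omega>))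
          = (CLINT \<omega>|M. ?IX \<omega> * iexp (t \<bullet> Y \<omega>) - ?p * iexp (t \<bullet> Y \<omega>))"
        by (simp add: left_diff_distrib)
      then show "(CLINT \<omega>|M. (?IX \<omega> - ?p) * iexp (t \<bullet> Y \<omega>)) = 0"
        using intI[of t] inte[of Y t] stepX[of t] by simp
    qed auto
    moreover have "(CLINT \<omega>|M. (?IX \<omega> - ?p) * ?IY \<omega>) = (CLINT \<omega>|M. ?IX \<omega> * ?IY \<omega> - ?p * ?IY \<omega>)"
      by (simp add: left_diff_distrib)
    moreover have "?IX \<omega> * ?IY \<omega> = indicator (box a b \<times> box c d) (X \<omega>, Y \<omega>)" for \<omega>
      by (auto split: split_indicator)
    ultimately have "complex_of_real (prob ((\<lambda>\<omega>. (X \<omega>, Y \<omega>)) -` (box a b \<times> box c d) \<inter> space M))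
        = ?p * prob (Y -` box c d \<inter> space M)"
      using intXY intY ind[of "\<lambda>\<omega>. (X \<omega>, Y \<omega>)" "box a b \<times> box c d"] ind[of Y "box c d"]
      by (simp add: open_Times open_box)
    moreover have "(\<lambda>\<omega>. (X \<omega>, Y \<omega>)) -` (box a b \<times> box c d) \<inter> space M
        = (X -` box a b \<inter> space M) \<inter> (Y -` box c d \<inter> space M)"
      by auto
    ultimately show ?thesis
      by (simp flip: of_real_mult)
  qed
  have stable: "Int_stable {Z -` box a b \<inter> space M | a b. True}" for Z :: "'a \<Rightarrow> 'd :: euclidean_space"
  proof (rule Int_stableI)
    fix A B assume "A \<in> {Z -` box a b \<inter> space M | a b. True}" "B \<in> {Z -` box a b \<inter> space M | a b. True}"
    then obtain a b c d where "A = Z -` box a b \<inter> space M" "B = Z -` box c d \<inter> space M"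
      by blast
    then have "A \<inter> B = Z -` (box a b \<inter> box c d) \<inter> space M" by auto
    then show "A \<inter> B \<in> {Z -` box a b \<inter> space M | a b. True}"
      unfolding box_Int_box by blast
  qed
  have "indep_set (rv_events M X) (rv_events M Y)"
    unfolding rv_events_eq_sigma_sets_boxes
  proof (rule indep_set_sigma_sets[OF _ stable stable])
    show "indep_set {X -` box a b \<inter> space M | a b. True} {Y -` box a b \<inter> space M | a b. True}"
      by (rule indep_setI) (auto simp: box)
  qed
  then show ?thesis
    by (simp add: indep_rv2_def)
qed

text \<open>The events of \<open>Y\<close> and \<open>Z\<close> combine to a rectangle event of the pair, so the probability of a triple
  intersection splits in two steps; the pairwise claims are the case where one event is \<open>space M\<close>.\<close>

lemma indep_rv3_if_indep_rv2:
  fixes X :: "'a \<Rightarrow> 'b :: second_countable_topology" and Y :: "'a \<Rightarrow> 'c :: second_countable_topology"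
    and Z :: "'a \<Rightarrow> 'd :: second_countable_topology"
  assumes X: "indep_rv2 M X (\<lambda>\<omega>. (Y \<omega>, Z \<omega>))" and YZ: "indep_rv2 M Y Z"
  shows "indep_rv3 M X Y Z" and "indep_rv2 M X Y" and "indep_rv2 M X Z"
proof -
  have [measurable]: "X \<in> borel_measurable M" "Y \<in> borel_measurable M" "Z \<in> borel_measurable M"
    using X YZ by (auto simp: indep_rv2_def)
  have sub: "rv_events M V \<subseteq> events" if [measurable]: "V \<in> borel_measurable M" for V :: "'a \<Rightarrow> 'e :: topological_space"
    by (auto simp: rv_events_def)
  have triple: "prob (A \<inter> B \<inter> C) = prob A * prob B * prob C"
    if A: "A \<in> rv_events M X" and B: "B \<in> rv_events M Y" and C: "C \<in> rv_events M Z" for A B C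
  proof -
    obtain B' C' where BC: "B = Y -` B' \<inter> space M" "C = Z -` C' \<inter> space M" "B' \<in> sets borel" "C' \<in> sets borel"
      using B C by (auto simp: rv_events_def)
    then have "B \<inter> C = (\<lambda>\<omega>. (Y \<omega>, Z \<omega>)) -` (B' \<times> C') \<inter> space M"
      by auto
    moreover have "B' \<times> C' \<in> sets borel"
      using BC by (simp add: borel_Times)
    ultimately have "B \<inter> C \<in> rv_events M (\<lambda>\<omega>. (Y \<omega>, Z \<omega>))"
      unfolding rv_events_def by blast
    then have "prob (A \<inter> (B \<inter> C)) = prob A * prob (B \<inter> C)"
      using X A unfolding indep_rv2_def by (blast intro: indep_setD)
    moreover have "prob (B \<inter> C) = prob B * prob C"
      using YZ B C unfolding indep_rv2_def by (blast intro: indep_setD)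
    ultimately show ?thesis
      by (simp add: Int_assoc)
  qed
  have space: "space M \<in> rv_events M V" for V :: "'a \<Rightarrow> 'e :: topological_space"
    unfolding rv_events_def by (intro CollectI exI[of _ UNIV]) auto
  have "indep_sets (\<lambda>i. [rv_events M X, rv_events M Y, rv_events M Z] ! i) {..<3}"
  proof (subst indep_sets_finite)
    show "[rv_events M X, rv_events M Y, rv_events M Z] ! i \<subseteq> events" if "i \<in> {..<3}" for i
      using that sub[of X] sub[of Y] sub[of Z] by (auto simp: less_Suc_eq numeral_3_eq_3)
    show "space M \<in> [rv_events M X, rv_events M Y, rv_events M Z] ! i" if "i \<in> {..<3}" for i
      using that space[of X] space[of Y] space[of Z] by (auto simp: less_Suc_eq numeral_3_eq_3)
    show "\<forall>A\<in>Pi {..<3} ((!) [rv_events M X, rv_events M Y, rv_events M Z]).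
        prob (\<Inter>j\<in>{..<3}. A j) = (\<Prod>j\<in>{..<3}. prob (A j))"
    proof
      fix A assume A: "A \<in> Pi {..<3} ((!) [rv_events M X, rv_events M Y, rv_events M Z])"
      have 3: "{..<3} = {0, 1, 2::nat}" by auto
      have "A 0 \<in> rv_events M X" "A 1 \<in> rv_events M Y" "A 2 \<in> rv_events M Z"
        using A by (auto simp: 3)
      from triple[OF this] show "prob (\<Inter>j\<in>{..<3}. A j) = (\<Prod>j\<in>{..<3}. prob (A j))"
        by (simp add: 3 Int_assoc mult.assoc)
    qed
  qed (auto simp: lessThan_empty_iff)
  then show "indep_rv3 M X Y Z"
    by (simp add: indep_rv3_def)
  show "indep_rv2 M X Y"
    unfolding indep_rv2_def
  proof (intro conjI indep_setI sub)
    fix A B assume "A \<in> rv_events M X" "B \<in> rv_events M Y"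
    moreover have "A \<inter> B \<inter> space M = A \<inter> B"
      using calculation by (auto simp: rv_events_def)
    ultimately show "prob (A \<inter> B) = prob A * prob B"
      using triple[of A B "space M"] space[of Z] by (simp add: prob_space)
  qed auto
  show "indep_rv2 M X Z"
    unfolding indep_rv2_def
  proof (intro conjI indep_setI sub)
    fix A C assume "A \<in> rv_events M X" "C \<in> rv_events M Z"
    moreover have "A \<inter> space M \<inter> C = A \<inter> C"
      using calculation by (auto simp: rv_events_def)
    ultimately show "prob (A \<inter> C) = prob A * prob C"
      using triple[of A "space M" C] space[of Y] by (simp add: prob_space)
  qed auto
qed

end

section \<open>Existence and calculus of mean-square derivatives\<close>

text \<open>For fields with values in \<open>L\<^sup>2\<close> the nonnegative integral in the definition agrees with the
  Bochner integral, so a mean-square derivative is an \<open>L\<^sup>2\<close>-limit of difference quotients.\<close>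

lemma has_ms_deriv_iff_L2:
  assumes Z: "\<And>x. L2 M (Z x)"
  shows "has_ms_deriv M Z v x Y \<longleftrightarrow>
    L2 M Y \<and> L2_tendsto M (\<lambda>t \<omega>. (Z (x + t *\<^sub>R v) \<omega> - Z x \<omega>) / t) Y (at 0)"
proof (cases "L2 M Y")
  case True
  have "(\<integral>\<^sup>+\<omega>. ennreal (((Z (x + t *\<^sub>R v) \<omega> - Z x \<omega>) / t - Y \<omega>)\<^sup>2) \<partial>M)
      = ennreal (\<integral>\<omega>. ((Z (x + t *\<^sub>R v) \<omega> - Z x \<omega>) / t - Y \<omega>)\<^sup>2 \<partial>M)" for t
    by (intro nn_integral_square_eq L2_diff L2_divide Z True)
  moreover have "((\<lambda>t. ennreal (f t)) \<longlongrightarrow> 0) (at 0) \<longleftrightarrow> (f \<longlongrightarrow> 0) (at 0)"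
    if "\<And>t. 0 \<le> f t" for f :: "real \<Rightarrow> real"
    using tendsto_ennreal_iff[of f "at 0" 0] that by simp
  ultimately show ?thesis
    using True by (simp add: has_ms_deriv_def L2_tendsto_def L2_def)
next
  case False
  then show ?thesis
    by (auto simp: has_ms_deriv_def L2_def)
qed

lemma has_ms_deriv_imp_L2: "has_ms_deriv M Z v x Y \<Longrightarrow> L2 M Y"
  by (simp add: has_ms_deriv_def L2_def)

lemma has_ms_deriv_unique:
  assumes "\<And>x. L2 M (Z x)" "has_ms_deriv M Z v x Y" "has_ms_deriv M Z v x Y'"
  shows "AE \<omega> in M. Y \<omega> = Y' \<omega>"
proof (rule L2_tendsto_unique)
  show "L2_tendsto M (\<lambda>t \<omega>. (Z (x + t *\<^sub>R v) \<omega> - Z x \<omega>) / t) Y (at 0)"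
    "L2_tendsto M (\<lambda>t \<omega>. (Z (x + t *\<^sub>R v) \<omega> - Z x \<omega>) / t) Y' (at 0)"
    "L2 M Y" "L2 M Y'"
    using assms by (simp_all add: has_ms_deriv_iff_L2)
  show "L2 M (\<lambda>\<omega>. (Z (x + t *\<^sub>R v) \<omega> - Z x \<omega>) / t)" for t
    by (intro L2_divide L2_diff assms(1))
qed simp

lemma has_ms_deriv_cong_AE:
  assumes "\<And>x. AE \<omega> in M. Z x \<omega> = Z' x \<omega>" "has_ms_deriv M Z v x Y"
  shows "has_ms_deriv M Z' v x Y"
proof -
  have "(\<integral>\<^sup>+\<omega>. ennreal (((Z (x + t *\<^sub>R v) \<omega> - Z x \<omega>) / t - Y \<omega>)\<^sup>2) \<partial>M)
      = (\<integral>\<^sup>+\<omega>. ennreal (((Z' (x + t *\<^sub>R v) \<omega> - Z' x \<omega>) / t - Y \<omega>)\<^sup>2) \<partial>M)" for t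
    using assms(1)[of "x + t *\<^sub>R v"] assms(1)[of x] by (intro nn_integral_cong_AE) auto
  then show ?thesis
    using assms(2) by (simp add: has_ms_deriv_def)
qed

lemma has_ms_deriv_diff:
  assumes Z: "\<And>x. L2 M (Z x)" and W: "\<And>x. L2 M (W x)"
    and "has_ms_deriv M Z v x Y" "has_ms_deriv M W v x X"
  shows "has_ms_deriv M (\<lambda>x \<omega>. Z x \<omega> - W x \<omega>) v x (\<lambda>\<omega>. Y \<omega> - X \<omega>)"
proof -
  have "L2 M Y" "L2 M X"
    using assms(3,4) by (auto dest: has_ms_deriv_imp_L2)
  moreover have "L2_tendsto M
      (\<lambda>t \<omega>. (Z (x + t *\<^sub>R v) \<omega> - Z x \<omega>) / t - (W (x + t *\<^sub>R v) \<omega> - W x \<omega>) / t) (\<lambda>\<omega>. Y \<omega> - X \<omega>) (at 0)"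
    using assms(3,4) by (intro L2_tendsto_diff L2_divide L2_diff Z W calculation)
      (simp_all add: has_ms_deriv_iff_L2 Z W)
  moreover have "(a - b) / t - (c - d) / t = (a - c - (b - d)) / t" for a b c d t :: real
    by (simp add: diff_divide_distrib)
  ultimately show ?thesis
    by (simp add: has_ms_deriv_iff_L2 Z W L2_diff)
qed

lemma has_ms_deriv_scale:
  assumes Z: "\<And>x. L2 M (Z x)" and "has_ms_deriv M Z v x Y"
  shows "has_ms_deriv M (\<lambda>x \<omega>. a * Z x \<omega>) v x (\<lambda>\<omega>. a * Y \<omega>)"
proof -
  have "L2_tendsto M (\<lambda>t \<omega>. a * ((Z (x + t *\<^sub>R v) \<omega> - Z x \<omega>) / t)) (\<lambda>\<omega>. a * Y \<omega>) (at 0)"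
    using assms by (intro L2_tendsto_scale) (simp add: has_ms_deriv_iff_L2)
  then have "L2_tendsto M (\<lambda>t \<omega>. (a * Z (x + t *\<^sub>R v) \<omega> - a * Z x \<omega>) / t) (\<lambda>\<omega>. a * Y \<omega>) (at 0)"
    by (simp only: times_divide_eq_right right_diff_distrib)
  then show ?thesis
    using assms by (simp add: has_ms_deriv_iff_L2 L2_scale)
qed

lemma has_ms_deriv_compose:
  assumes "has_ms_deriv M Z w (R x) Y" "\<And>t. R (x + t *\<^sub>R v) = R x + t *\<^sub>R w"
  shows "has_ms_deriv M (\<lambda>x. Z (R x)) v x Y"
  using assms by (simp add: has_ms_deriv_def)

lemma has_ms_deriv_uminus_direction:
  assumes Z: "\<And>x. L2 M (Z x)" and "has_ms_deriv M Z v x Y"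
  shows "has_ms_deriv M Z (- v) x (\<lambda>\<omega>. - Y \<omega>)"
proof -
  have "((\<lambda>t. \<integral>\<omega>. ((Z (x + t *\<^sub>R v) \<omega> - Z x \<omega>) / t - Y \<omega>)\<^sup>2 \<partial>M) \<longlongrightarrow> 0) (at 0)"
    using assms by (simp add: has_ms_deriv_iff_L2 L2_tendsto_def)
  moreover have "filterlim uminus (at 0) (at (0::real))"
    by (simp add: filterlim_def filtermap_at_minus)
  ultimately have "((\<lambda>t. \<integral>\<omega>. ((Z (x + (- t) *\<^sub>R v) \<omega> - Z x \<omega>) / (- t) - Y \<omega>)\<^sup>2 \<partial>M) \<longlongrightarrow> 0) (at 0)"
    by (rule filterlim_compose)
  moreover have "(a / (- t) - b)\<^sup>2 = (a / t - (- b))\<^sup>2" for a b t :: real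
    by (simp add: power2_eq_square algebra_simps)
  ultimately show ?thesis
    using assms by (simp add: has_ms_deriv_iff_L2 L2_tendsto_def L2_minus)
qed

lemma Ck_imp_continuous_on: "Ck n f \<Longrightarrow> continuous_on UNIV f"
proof (cases n)
  case (Suc m)
  assume "Ck n f"
  with Suc obtain f' where "\<And>x. (f has_derivative f' x) (at x)"
    by auto
  then show ?thesis
    by (intro has_derivative_continuous_on[of UNIV f f']) simp
qed simp

lemma has_real_derivative_along_line:
  assumes "(K has_derivative D) (at (p + \<tau> *\<^sub>R d))"
  shows "((\<lambda>\<tau>. K (p + \<tau> *\<^sub>R d)) has_real_derivative D d) (at \<tau>)"
proof -
  have "((\<lambda>\<tau>. p + \<tau> *\<^sub>R d) has_derivative (\<lambda>h. h *\<^sub>R d)) (at \<tau>)"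
    by (auto intro!: derivative_eq_intros)
  from has_derivative_compose[OF this assms]
  have "((\<lambda>\<tau>. K (p + \<tau> *\<^sub>R d)) has_derivative (\<lambda>h. D (h *\<^sub>R d))) (at \<tau>)" .
  moreover have "D (h *\<^sub>R d) = D d * h" for h
    using linear_scale[OF has_derivative_linear[OF assms]] by simp
  ultimately show ?thesis
    by (simp add: has_field_derivative_def)
qed

lemma mean_value_at_0:
  fixes g g' :: "real \<Rightarrow> real"
  assumes "\<And>\<tau>. (g has_real_derivative g' \<tau>) (at \<tau>)"
  shows "\<exists>\<xi>. \<bar>\<xi>\<bar> \<le> \<bar>s\<bar> \<and> g s - g 0 = s * g' \<xi>"
proof -
  consider "s = 0" | "0 < s" | "s < 0" by linarith
  then show ?thesis
  proof cases
    case 2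
    obtain z where "0 < z" "z < s" "g s - g 0 = (s - 0) * g' z"
      using MVT2[OF 2 assms] by blast
    then show ?thesis by (intro exI[of _ z]) auto
  next
    case 3
    obtain z where "s < z" "z < 0" "g 0 - g s = (0 - s) * g' z"
      using MVT2[OF 3 assms] by blast
    then show ?thesis by (intro exI[of _ z]) auto
  qed auto
qed

text \<open>With \<open>q x t\<close> the difference quotient at \<open>x\<close>, the covariance of \<open>q x s\<close> and \<open>q y t\<close> is a mixed second
  difference quotient of \<open>K\<close>. Two uses of the mean value theorem turn it into a value near \<open>(x, y)\<close> of
  the mixed derivative \<open>K2\<close>, once in each argument; by continuity it tends to \<open>K2 (x, y)\<close> as \<open>s\<close> and
  \<open>t\<close> tend to \<open>0\<close> independently. For \<open>x = y\<close> this makes \<open>q x\<close> Cauchy, since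
  \<open>E (q x s - q x t)\<^sup>2\<close> tends to \<open>K2 (x, x) - 2 K2 (x, x) + K2 (x, x)\<close>; for general \<open>x\<close> and \<open>y\<close> it
  identifies \<open>K2\<close> as the covariance function of the derivative, ready for another application.\<close>

lemma (in prob_space) ms_deriv_exists:
  fixes Z :: "'p :: euclidean_space \<Rightarrow> 'a \<Rightarrow> real"
  assumes Z: "\<And>x. L2 M (Z x)"
    and K: "Ck (Suc (Suc m)) (\<lambda>(x, y). \<integral>\<omega>. Z x \<omega> * Z y \<omega> \<partial>M)"
  shows "\<exists>Z'. (\<forall>x. has_ms_deriv M Z v x (Z' x)) \<and> Ck m (\<lambda>(x, y). \<integral>\<omega>. Z' x \<omega> * Z' y \<omega> \<partial>M)"
proof -
  define K where "K = (\<lambda>(x, y). \<integral>\<omega>. Z x \<omega> * Z y \<omega> \<partial>M)"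
  obtain K' where K': "\<And>p. (K has_derivative K' p) (at p)" and Ck1: "Ck (Suc m) (\<lambda>p. K' p (v, 0))"
    using assms(2) unfolding K_def[symmetric] Ck.simps(2)[of "Suc m"] by blast
  then obtain K1' where K1': "\<And>p. ((\<lambda>p. K' p (v, 0)) has_derivative K1' p) (at p)"
    and Ck2: "Ck m (\<lambda>p. K1' p (0, v))"
    unfolding Ck.simps(2)[of m] by blast
  define K1 where "K1 p = K' p (v, 0)" for p
  define K2 where "K2 p = K1' p (0, v)" for p
  define q where "q x t \<omega> = (Z (x + t *\<^sub>R v) \<omega> - Z x \<omega>) / t" for x t \<omega>
  have q: "L2 M (q x t)" for x t
    unfolding q_def by (intro L2_divide L2_diff Z)
  have Eq: "(\<integral>\<omega>. q x s \<omega> * q y t \<omega> \<partial>M) = (K (x + s *\<^sub>R v, y + t *\<^sub>R v) - K (x + s *\<^sub>R v, y)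
      - (K (x, y + t *\<^sub>R v) - K (x, y))) / (s * t)" for x y s t
  proof -
    have "(\<integral>\<omega>. q x s \<omega> * q y t \<omega> \<partial>M) = (\<integral>\<omega>. (Z (x + s *\<^sub>R v) \<omega> * Z (y + t *\<^sub>R v) \<omega>
        - Z (x + s *\<^sub>R v) \<omega> * Z y \<omega> - (Z x \<omega> * Z (y + t *\<^sub>R v) \<omega> - Z x \<omega> * Z y \<omega>)) / (s * t) \<partial>M)"
      unfolding q_def by (intro Bochner_Integration.integral_cong refl) (simp add: field_simps)
    also have "\<dots> = (K (x + s *\<^sub>R v, y + t *\<^sub>R v) - K (x + s *\<^sub>R v, y)
      - (K (x, y + t *\<^sub>R v) - K (x, y))) / (s * t)"
      by (simp add: K_def L2_integrable_mult[OF Z Z])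
    finally show ?thesis .
  qed
  have mean_value: "\<exists>\<xi> \<eta>. \<bar>\<xi>\<bar> \<le> \<bar>s\<bar> \<and> \<bar>\<eta>\<bar> \<le> \<bar>t\<bar> \<and>
      (\<integral>\<omega>. q x s \<omega> * q y t \<omega> \<partial>M) = K2 (x + \<xi> *\<^sub>R v, y + \<eta> *\<^sub>R v)" if "s \<noteq> 0" "t \<noteq> 0" for x y s t
  proof -
    have D1: "((\<lambda>\<tau>. K (x + \<tau> *\<^sub>R v, c)) has_real_derivative K1 (x + \<tau> *\<^sub>R v, c)) (at \<tau>)" for c \<tau>
      using has_real_derivative_along_line[of K "K' (x + \<tau> *\<^sub>R v, c)" "(x, c)" \<tau> "(v, 0)"] K'
      by (simp add: K1_def)
    have D2: "((\<lambda>\<tau>. K1 (c, y + \<tau> *\<^sub>R v)) has_real_derivative K2 (c, y + \<tau> *\<^sub>R v)) (at \<tau>)" for c \<tau>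
      using has_real_derivative_along_line[of K1 "K1' (c, y + \<tau> *\<^sub>R v)" "(c, y)" \<tau> "(0, v)"] K1'
      by (simp add: K1_def[abs_def] K2_def)
    obtain \<xi> where \<xi>: "\<bar>\<xi>\<bar> \<le> \<bar>s\<bar>" "K (x + s *\<^sub>R v, y + t *\<^sub>R v) - K (x + s *\<^sub>R v, y)
        - (K (x, y + t *\<^sub>R v) - K (x, y)) = s * (K1 (x + \<xi> *\<^sub>R v, y + t *\<^sub>R v) - K1 (x + \<xi> *\<^sub>R v, y))"
      using mean_value_at_0[of "\<lambda>\<tau>. K (x + \<tau> *\<^sub>R v, y + t *\<^sub>R v) - K (x + \<tau> *\<^sub>R v, y)", OF DERIV_diff[OF D1 D1], of s]
      by auto
    obtain \<eta> where \<eta>: "\<bar>\<eta>\<bar> \<le> \<bar>t\<bar>" "K1 (x + \<xi> *\<^sub>R v, y + t *\<^sub>R v) - K1 (x + \<xi> *\<^sub>R v, y)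
        = t * K2 (x + \<xi> *\<^sub>R v, y + \<eta> *\<^sub>R v)"
      using mean_value_at_0[of "\<lambda>\<tau>. K1 (x + \<xi> *\<^sub>R v, y + \<tau> *\<^sub>R v)", OF D2, of t] by auto
    show ?thesis
      unfolding Eq using \<xi> \<eta> that by (intro exI[of _ \<xi>] exI[of _ \<eta>]) simp
  qed
  have cont: "continuous_on UNIV K2"
    using Ck_imp_continuous_on[OF Ck2] by (simp add: K2_def[abs_def])
  have near: "\<exists>d>0. \<forall>s t. 0 < \<bar>s\<bar> \<and> \<bar>s\<bar> < d \<and> 0 < \<bar>t\<bar> \<and> \<bar>t\<bar> < d \<longrightarrow>
      \<bar>(\<integral>\<omega>. q x s \<omega> * q y t \<omega> \<partial>M) - K2 (x, y)\<bar> < e" if "e > 0" for x y e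
  proof -
    have "continuous_on UNIV (\<lambda>(a, b). K2 (x + a *\<^sub>R v, y + b *\<^sub>R v))"
      unfolding split_def by (intro continuous_on_compose2[OF cont] continuous_intros) auto
    then obtain d where "d > 0"
      and d: "\<And>a b. dist (a, b) (0, 0) < d \<Longrightarrow> dist (K2 (x + a *\<^sub>R v, y + b *\<^sub>R v)) (K2 (x, y)) < e"
      using \<open>e > 0\<close> by (force simp: continuous_on_iff dest: bspec[where x = "(0::real, 0::real)"])
    have "\<bar>(\<integral>\<omega>. q x s \<omega> * q y t \<omega> \<partial>M) - K2 (x, y)\<bar> < e"
      if st: "0 < \<bar>s\<bar>" "\<bar>s\<bar> < d / 2" "0 < \<bar>t\<bar>" "\<bar>t\<bar> < d / 2" for s t
    proof -
      obtain \<xi> \<eta> where "\<bar>\<xi>\<bar> \<le> \<bar>s\<bar>" "\<bar>\<eta>\<bar> \<le> \<bar>t\<bar>"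
        and eq: "(\<integral>\<omega>. q x s \<omega> * q y t \<omega> \<partial>M) = K2 (x + \<xi> *\<^sub>R v, y + \<eta> *\<^sub>R v)"
        using mean_value[of s t x y] st by auto
      then have "dist (\<xi>, \<eta>) (0, 0) < d"
        using norm_Pair_le[of \<xi> \<eta>] st by (simp add: dist_norm)
      then show ?thesis
        using d[of \<xi> \<eta>] eq by (simp add: dist_real_def)
    qed
    then show ?thesis
      using \<open>d > 0\<close> by (intro exI[of _ "d / 2"]) auto
  qed
  have "\<exists>Y. L2 M Y \<and> L2_tendsto M (q x) Y (at 0)" for x
  proof (rule L2_complete_at_0)
    fix e :: real assume "e > 0"
    then obtain d where "d > 0" and d: "\<And>s t. 0 < \<bar>s\<bar> \<Longrightarrow> \<bar>s\<bar> < d \<Longrightarrow> 0 < \<bar>t\<bar> \<Longrightarrow> \<bar>t\<bar> < d \<Longrightarrow>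
      \<bar>(\<integral>\<omega>. q x s \<omega> * q x t \<omega> \<partial>M) - K2 (x, x)\<bar> < e / 4"
      using near[of "e / 4" x x] by auto
    have "(\<integral>\<omega>. (q x s \<omega> - q x t \<omega>)\<^sup>2 \<partial>M) \<le> e"
      if st: "0 < \<bar>s\<bar>" "\<bar>s\<bar> < d" "0 < \<bar>t\<bar>" "\<bar>t\<bar> < d" for s t
    proof -
      have "(\<integral>\<omega>. (q x s \<omega> - q x t \<omega>)\<^sup>2 \<partial>M)
        = (\<integral>\<omega>. q x s \<omega> * q x s \<omega> - 2 * (q x s \<omega> * q x t \<omega>) + q x t \<omega> * q x t \<omega> \<partial>M)"
        by (intro Bochner_Integration.integral_cong refl) (simp add: power2_eq_square algebra_simps)
      also have "\<dots> = (\<integral>\<omega>. q x s \<omega> * q x s \<omega> \<partial>M) - 2 * (\<integral>\<omega>. q x s \<omega> * q x t \<omega> \<partial>M)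
          + (\<integral>\<omega>. q x t \<omega> * q x t \<omega> \<partial>M)"
        by (simp add: L2_integrable_mult[OF q q])
      finally show ?thesis
        using d[of s s] d[of s t] d[of t t] st by linarith
    qed
    then show "\<exists>d>0. \<forall>s t. 0 < \<bar>s\<bar> \<and> \<bar>s\<bar> < d \<and> 0 < \<bar>t\<bar> \<and> \<bar>t\<bar> < d \<longrightarrow>
      (\<integral>\<omega>. (q x s \<omega> - q x t \<omega>)\<^sup>2 \<partial>M) \<le> e"
      using \<open>d > 0\<close> by blast
  qed (rule q)
  then obtain Z' where Z': "\<And>x. L2 M (Z' x)" and lim: "\<And>x. L2_tendsto M (q x) (Z' x) (at 0)"
    by metis
  have "(\<integral>\<omega>. Z' x \<omega> * Z' y \<omega> \<partial>M) = K2 (x, y)" for x y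
  proof (rule tendsto_unique)
    show "((\<lambda>t. \<integral>\<omega>. q x t \<omega> * q y t \<omega> \<partial>M) \<longlongrightarrow> (\<integral>\<omega>. Z' x \<omega> * Z' y \<omega> \<partial>M)) (at 0)"
      by (intro L2_tendsto_integral_mult q Z' lim)
    show "((\<lambda>t. \<integral>\<omega>. q x t \<omega> * q y t \<omega> \<partial>M) \<longlongrightarrow> K2 (x, y)) (at 0)"
    proof (rule tendstoI)
      fix e :: real assume "e > 0"
      from near[OF this, of x y] show "\<forall>\<^sub>F t in at 0. dist (\<integral>\<omega>. q x t \<omega> * q y t \<omega> \<partial>M) (K2 (x, y)) < e"
        unfolding eventually_at by (auto simp: dist_real_def)
    qed
  qed simp
  then have "(\<lambda>(x, y). \<integral>\<omega>. Z' x \<omega> * Z' y \<omega> \<partial>M) = (\<lambda>p. K1' p (0, v))"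
    by (auto simp: K2_def)
  moreover have "has_ms_deriv M Z v x (Z' x)" for x
    using Z' lim[of x] by (simp add: has_ms_deriv_iff_L2[OF Z] q_def[abs_def])
  ultimately show ?thesis
    using Ck2 by (intro exI[of _ Z']) simp
qed

section \<open>Symmetries of a random field\<close>

text \<open>If \<open>u\<close> and \<open>u'\<close> have the same covariance function, \<open>u x \<mapsto> u' x\<close> extends to an isometry \<open>T\<close> from the
  closed span of \<open>u\<close> to that of \<open>u'\<close>, and this relation is the graph of \<open>T\<close>. A relation avoids
  choosing representatives modulo almost sure equality.\<close>

definition coupled :: "'a measure \<Rightarrow> ('p \<Rightarrow> 'a \<Rightarrow> real) \<Rightarrow> ('p \<Rightarrow> 'a \<Rightarrow> real) \<Rightarrow>
    ('a \<Rightarrow> real) \<Rightarrow> ('a \<Rightarrow> real) \<Rightarrow> bool" where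
  "coupled M u u' Y Y' \<longleftrightarrow> L2 M Y \<and> L2 M Y' \<and>
    (\<forall>e>0. \<exists>S c. finite S \<and> (\<integral>\<omega>. (Y \<omega> - (\<Sum>x\<in>S. c x * u x \<omega>))\<^sup>2 \<partial>M) < e \<and>
      (\<integral>\<omega>. (Y' \<omega> - (\<Sum>x\<in>S. c x * u' x \<omega>))\<^sup>2 \<partial>M) < e)"

locale L2_fields = prob_space M for M :: "'a measure" +
  fixes u u' :: "'p \<Rightarrow> 'a \<Rightarrow> real"
  assumes L2_u: "L2 M (u x)" and L2_u': "L2 M (u' x)"
begin

lemma L2_comb: "L2 M (\<lambda>\<omega>. \<Sum>x\<in>S. c x * u x \<omega>)" "L2 M (\<lambda>\<omega>. \<Sum>x\<in>S. c x * u' x \<omega>)"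
  by (intro L2_sum L2_scale L2_u L2_u')+

lemma coupled_base: "coupled M u u' (u x) (u' x)"
  unfolding coupled_def
  by (auto simp: L2_u L2_u' intro!: exI[of _ "{x}"] exI[of _ "\<lambda>_. 1"])

lemma coupled_zero: "coupled M u u' (\<lambda>\<omega>. 0) (\<lambda>\<omega>. 0)"
  unfolding coupled_def by (auto simp: L2_zero intro!: exI[of _ "{}"])

lemma coupled_scale:
  assumes "coupled M u u' Y Y'"
  shows "coupled M u u' (\<lambda>\<omega>. a * Y \<omega>) (\<lambda>\<omega>. a * Y' \<omega>)"
  unfolding coupled_def
proof (intro conjI allI impI)
  fix e :: real assume "e > 0"
  then have "e / (a\<^sup>2 + 1) > 0"
    by (intro divide_pos_pos) (auto intro: add_nonneg_pos)
  then obtain S c where Sc: "finite S" "(\<integral>\<omega>. (Y \<omega> - (\<Sum>x\<in>S. c x * u x \<omega>))\<^sup>2 \<partial>M) < e / (a\<^sup>2 + 1)"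
      "(\<integral>\<omega>. (Y' \<omega> - (\<Sum>x\<in>S. c x * u' x \<omega>))\<^sup>2 \<partial>M) < e / (a\<^sup>2 + 1)"
    using assms unfolding coupled_def by blast
  have *: "a\<^sup>2 * r < e" if "r < e / (a\<^sup>2 + 1)" "0 \<le> r" for r
  proof -
    have "r * (a\<^sup>2 + 1) < e"
      using that by (subst (asm) pos_less_divide_eq) (auto intro: add_nonneg_pos)
    then show ?thesis using that by (simp add: algebra_simps)
  qed
  have eq: "(\<integral>\<omega>. (a * V \<omega> - (\<Sum>x\<in>S. a * c x * w x \<omega>))\<^sup>2 \<partial>M) = a\<^sup>2 * (\<integral>\<omega>. (V \<omega> - (\<Sum>x\<in>S. c x * w x \<omega>))\<^sup>2 \<partial>M)"
    for V and w :: "'p \<Rightarrow> 'a \<Rightarrow> real"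
    by (simp add: mult.assoc power_mult_distrib flip: sum_distrib_left right_diff_distrib)
  show "\<exists>S c. finite S \<and> (\<integral>\<omega>. (a * Y \<omega> - (\<Sum>x\<in>S. c x * u x \<omega>))\<^sup>2 \<partial>M) < e \<and>
      (\<integral>\<omega>. (a * Y' \<omega> - (\<Sum>x\<in>S. c x * u' x \<omega>))\<^sup>2 \<partial>M) < e"
    using Sc by (intro exI[of _ S] exI[of _ "\<lambda>x. a * c x"]) (simp add: eq *)
qed (use assms in \<open>auto simp: coupled_def intro: L2_scale\<close>)

lemma coupled_add:
  assumes "coupled M u u' Y Y'" "coupled M u u' X X'"
  shows "coupled M u u' (\<lambda>\<omega>. Y \<omega> + X \<omega>) (\<lambda>\<omega>. Y' \<omega> + X' \<omega>)"
  unfolding coupled_def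
proof (intro conjI allI impI)
  have L2: "L2 M Y" "L2 M Y'" "L2 M X" "L2 M X'"
    using assms by (auto simp: coupled_def)
  fix e :: real assume "e > 0"
  then have "e / 4 > 0" by simp
  obtain S c where Sc: "finite S" "(\<integral>\<omega>. (Y \<omega> - (\<Sum>x\<in>S. c x * u x \<omega>))\<^sup>2 \<partial>M) < e / 4"
      "(\<integral>\<omega>. (Y' \<omega> - (\<Sum>x\<in>S. c x * u' x \<omega>))\<^sup>2 \<partial>M) < e / 4"
    using assms(1) \<open>e / 4 > 0\<close> unfolding coupled_def by blast
  obtain T d where Td: "finite T" "(\<integral>\<omega>. (X \<omega> - (\<Sum>x\<in>T. d x * u x \<omega>))\<^sup>2 \<partial>M) < e / 4"
      "(\<integral>\<omega>. (X' \<omega> - (\<Sum>x\<in>T. d x * u' x \<omega>))\<^sup>2 \<partial>M) < e / 4"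
    using assms(2) \<open>e / 4 > 0\<close> unfolding coupled_def by blast
  \<comment> \<open>The two combinations may use different points, so both are extended by 0 to the union.\<close>
  define b where "b x = (if x \<in> S then c x else 0) + (if x \<in> T then d x else 0)" for x
  have b: "(\<Sum>x\<in>S \<union> T. b x * w x \<omega>) = (\<Sum>x\<in>S. c x * w x \<omega>) + (\<Sum>x\<in>T. d x * w x \<omega>)"
    for w :: "'p \<Rightarrow> 'a \<Rightarrow> real" and \<omega>
  proof -
    have "(\<Sum>x\<in>S \<union> T. b x * w x \<omega>) = (\<Sum>x\<in>S \<union> T. if x \<in> S then c x * w x \<omega> else 0)
        + (\<Sum>x\<in>S \<union> T. if x \<in> T then d x * w x \<omega> else 0)"
      by (subst sum.distrib[symmetric]) (auto simp: b_def distrib_right intro!: sum.cong)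
    then show ?thesis
      using Sc(1) Td(1) by (simp add: sum.If_cases Int_absorb1 Int_Un_distrib2 Un_Int_distrib2)
  qed
  have less: "(\<integral>\<omega>. (V \<omega> + W \<omega> - (v \<omega> + w \<omega>))\<^sup>2 \<partial>M) < e"
    if "L2 M V" "L2 M W" "L2 M v" "L2 M w"
      "(\<integral>\<omega>. (V \<omega> - v \<omega>)\<^sup>2 \<partial>M) < e / 4" "(\<integral>\<omega>. (W \<omega> - w \<omega>)\<^sup>2 \<partial>M) < e / 4" for V W v w
  proof -
    have "(\<integral>\<omega>. (V \<omega> + W \<omega> - (v \<omega> + w \<omega>))\<^sup>2 \<partial>M) = (\<integral>\<omega>. ((V \<omega> - v \<omega>) + (W \<omega> - w \<omega>))\<^sup>2 \<partial>M)"
      by (intro Bochner_Integration.integral_cong refl) (simp add: algebra_simps)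
    then show ?thesis
      using integral_square_add_le[OF L2_diff[OF that(1,3)] L2_diff[OF that(2,4)]] that(5,6) by linarith
  qed
  show "\<exists>S c. finite S \<and> (\<integral>\<omega>. (Y \<omega> + X \<omega> - (\<Sum>x\<in>S. c x * u x \<omega>))\<^sup>2 \<partial>M) < e \<and>
      (\<integral>\<omega>. (Y' \<omega> + X' \<omega> - (\<Sum>x\<in>S. c x * u' x \<omega>))\<^sup>2 \<partial>M) < e"
    using Sc Td by (intro exI[of _ "S \<union> T"] exI[of _ b]) (auto simp: b intro!: less L2 L2_comb)
qed (use assms in \<open>auto simp: coupled_def intro: L2_add\<close>)

lemma coupled_diff:
  "coupled M u u' Y Y' \<Longrightarrow> coupled M u u' X X' \<Longrightarrow> coupled M u u' (\<lambda>\<omega>. Y \<omega> - X \<omega>) (\<lambda>\<omega>. Y' \<omega> - X' \<omega>)"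
  using coupled_add[OF _ coupled_scale, of Y Y' X X' "-1"] by simp

lemma coupled_sum:
  "(\<And>i. i \<in> I \<Longrightarrow> coupled M u u' (Y i) (Y' i)) \<Longrightarrow>
    coupled M u u' (\<lambda>\<omega>. \<Sum>i\<in>I. Y i \<omega>) (\<lambda>\<omega>. \<Sum>i\<in>I. Y' i \<omega>)"
  by (induction I rule: infinite_finite_induct) (auto intro: coupled_zero coupled_add)

lemma coupled_limit:
  assumes X: "\<And>t. coupled M u u' (X t) (X' t)" and Y: "L2 M Y" "L2 M Y'"
    and lim: "L2_tendsto M X Y F" "L2_tendsto M X' Y' F" and "F \<noteq> bot"
  shows "coupled M u u' Y Y'"
  unfolding coupled_def
proof (intro conjI allI impI)
  have L2: "L2 M (X t)" "L2 M (X' t)" for t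
    using X by (auto simp: coupled_def)
  fix e :: real assume "e > 0"
  then have "e / 4 > 0" by simp
  note near = lim[unfolded L2_tendsto_def, THEN order_tendstoD(2), OF \<open>e / 4 > 0\<close>]
  have "\<forall>\<^sub>F t in F. (\<integral>\<omega>. (X t \<omega> - Y \<omega>)\<^sup>2 \<partial>M) < e / 4 \<and> (\<integral>\<omega>. (X' t \<omega> - Y' \<omega>)\<^sup>2 \<partial>M) < e / 4"
    by (rule eventually_conj[OF near])
  then obtain t where t: "(\<integral>\<omega>. (X t \<omega> - Y \<omega>)\<^sup>2 \<partial>M) < e / 4" "(\<integral>\<omega>. (X' t \<omega> - Y' \<omega>)\<^sup>2 \<partial>M) < e / 4"
    using eventually_happens'[OF \<open>F \<noteq> bot\<close>] by blast
  obtain S c where Sc: "finite S" "(\<integral>\<omega>. (X t \<omega> - (\<Sum>x\<in>S. c x * u x \<omega>))\<^sup>2 \<partial>M) < e / 4"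
      "(\<integral>\<omega>. (X' t \<omega> - (\<Sum>x\<in>S. c x * u' x \<omega>))\<^sup>2 \<partial>M) < e / 4"
    using X[of t] \<open>e / 4 > 0\<close> unfolding coupled_def by blast
  have "(\<integral>\<omega>. (Y \<omega> - (\<Sum>x\<in>S. c x * u x \<omega>))\<^sup>2 \<partial>M) < e"
    using integral_square_triangle[OF Y(1) L2(1)[of t] L2_comb(1)[of c S]] t Sc by (simp add: power2_commute)
  moreover have "(\<integral>\<omega>. (Y' \<omega> - (\<Sum>x\<in>S. c x * u' x \<omega>))\<^sup>2 \<partial>M) < e"
    using integral_square_triangle[OF Y(2) L2(2)[of t] L2_comb(2)[of c S]] t Sc by (simp add: power2_commute)
  ultimately show "\<exists>S c. finite S \<and> (\<integral>\<omega>. (Y \<omega> - (\<Sum>x\<in>S. c x * u x \<omega>))\<^sup>2 \<partial>M) < e \<and>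
      (\<integral>\<omega>. (Y' \<omega> - (\<Sum>x\<in>S. c x * u' x \<omega>))\<^sup>2 \<partial>M) < e"
    using Sc(1) by blast
qed (use Y in auto)

lemma coupled_cong_AE:
  assumes "coupled M u u' Y Y'" "L2 M X" "L2 M X'" "AE \<omega> in M. Y \<omega> = X \<omega>" "AE \<omega> in M. Y' \<omega> = X' \<omega>"
  shows "coupled M u u' X X'"
proof (rule coupled_limit[where F = sequentially])
  have *: "(\<integral>\<omega>. (V \<omega> - W \<omega>)\<^sup>2 \<partial>M) = 0" if "AE \<omega> in M. V \<omega> = W \<omega>" for V W :: "'a \<Rightarrow> real"
    using that by (intro integral_eq_zero_AE) auto
  show "L2_tendsto M (\<lambda>_. Y) X sequentially" "L2_tendsto M (\<lambda>_. Y') X' sequentially"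
    using assms(4,5) by (simp_all add: L2_tendsto_def *)
qed (use assms in auto)

lemma coupled_sequence:
  assumes "coupled M u u' Y Y'"
  obtains S c where "\<And>n::nat. finite (S n)"
    and "L2_tendsto M (\<lambda>n \<omega>. \<Sum>x\<in>S n. c n x * u x \<omega>) Y sequentially"
    and "L2_tendsto M (\<lambda>n \<omega>. \<Sum>x\<in>S n. c n x * u' x \<omega>) Y' sequentially"
proof -
  have "\<forall>n::nat. \<exists>Sc. finite (fst Sc) \<and>
      (\<integral>\<omega>. (Y \<omega> - (\<Sum>x\<in>fst Sc. snd Sc x * u x \<omega>))\<^sup>2 \<partial>M) < inverse (Suc n) \<and>
      (\<integral>\<omega>. (Y' \<omega> - (\<Sum>x\<in>fst Sc. snd Sc x * u' x \<omega>))\<^sup>2 \<partial>M) < inverse (Suc n)"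
    using assms unfolding coupled_def by simp
  from choice[OF this] obtain Sc where Sc: "\<And>n::nat. finite (fst (Sc n))"
    "\<And>n. (\<integral>\<omega>. (Y \<omega> - (\<Sum>x\<in>fst (Sc n). snd (Sc n) x * u x \<omega>))\<^sup>2 \<partial>M) < inverse (Suc n)"
    "\<And>n. (\<integral>\<omega>. (Y' \<omega> - (\<Sum>x\<in>fst (Sc n). snd (Sc n) x * u' x \<omega>))\<^sup>2 \<partial>M) < inverse (Suc n)"
    by blast
  have "(f \<longlongrightarrow> 0) sequentially" if "\<And>n. 0 \<le> f n" "\<And>n. f n < inverse (real (Suc n))" for f
    using that by (intro tendsto_sandwich[OF _ _ tendsto_const LIMSEQ_inverse_real_of_nat])
      (auto intro!: always_eventually less_imp_le simp del: of_nat_Suc)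
  then show ?thesis
    using Sc by (intro that[of "\<lambda>n. fst (Sc n)" "\<lambda>n. snd (Sc n)"])
      (auto simp: L2_tendsto_def power2_commute[of _ "Y _"] power2_commute[of _ "Y' _"])
qed

text \<open>\<open>T\<close> preserves inner products: on finite combinations this is the equality of the covariance
  functions, and both sides are continuous in \<open>L\<^sup>2\<close>.\<close>

lemma coupled_integral_mult:
  assumes cov: "\<And>x y. (\<integral>\<omega>. u x \<omega> * u y \<omega> \<partial>M) = (\<integral>\<omega>. u' x \<omega> * u' y \<omega> \<partial>M)"
    and Y: "coupled M u u' Y Y'" and X: "coupled M u u' X X'"
  shows "(\<integral>\<omega>. Y \<omega> * X \<omega> \<partial>M) = (\<integral>\<omega>. Y' \<omega> * X' \<omega> \<partial>M)"
proof -
  have L2: "L2 M Y" "L2 M Y'" "L2 M X" "L2 M X'"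
    using X Y by (auto simp: coupled_def)
  obtain S c where Sc: "L2_tendsto M (\<lambda>n \<omega>. \<Sum>x\<in>S n. c n x * u x \<omega>) Y sequentially"
    "L2_tendsto M (\<lambda>n \<omega>. \<Sum>x\<in>S n. c n x * u' x \<omega>) Y' sequentially"
    using coupled_sequence[OF Y] by blast
  obtain T d where Td: "L2_tendsto M (\<lambda>n \<omega>. \<Sum>x\<in>T n. d n x * u x \<omega>) X sequentially"
    "L2_tendsto M (\<lambda>n \<omega>. \<Sum>x\<in>T n. d n x * u' x \<omega>) X' sequentially"
    using coupled_sequence[OF X] by blast
  have expand: "(\<integral>\<omega>. (\<Sum>x\<in>A. a x * w x \<omega>) * (\<Sum>y\<in>B. b y * w y \<omega>) \<partial>M)
      = (\<Sum>x\<in>A. \<Sum>y\<in>B. a x * b y * (\<integral>\<omega>. w x \<omega> * w y \<omega> \<partial>M))"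
    if "\<And>x. L2 M (w x)" for A B a b and w :: "'p \<Rightarrow> 'a \<Rightarrow> real"
  proof -
    have "(\<integral>\<omega>. (\<Sum>x\<in>A. a x * w x \<omega>) * (\<Sum>y\<in>B. b y * w y \<omega>) \<partial>M)
      = (\<integral>\<omega>. (\<Sum>x\<in>A. \<Sum>y\<in>B. a x * b y * (w x \<omega> * w y \<omega>)) \<partial>M)"
      by (simp add: sum_product mult_ac)
    also have "\<dots> = (\<Sum>x\<in>A. \<Sum>y\<in>B. a x * b y * (\<integral>\<omega>. w x \<omega> * w y \<omega> \<partial>M))"
      using L2_integrable_mult[OF that that] by (simp add: Bochner_Integration.integral_sum)
    finally show ?thesis .
  qed
  show ?thesis
  proof (rule LIMSEQ_unique)
    show "(\<lambda>n. \<integral>\<omega>. (\<Sum>x\<in>S n. c n x * u x \<omega>) * (\<Sum>x\<in>T n. d n x * u x \<omega>) \<partial>M) \<longlonglongrightarrow> (\<integral>\<omega>. Y \<omega> * X \<omega> \<partial>M)"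
      by (rule L2_tendsto_integral_mult[OF L2_comb(1) L2_comb(1) L2(1,3) Sc(1) Td(1)])
    have "(\<lambda>n. \<integral>\<omega>. (\<Sum>x\<in>S n. c n x * u' x \<omega>) * (\<Sum>x\<in>T n. d n x * u' x \<omega>) \<partial>M) \<longlonglongrightarrow> (\<integral>\<omega>. Y' \<omega> * X' \<omega> \<partial>M)"
      by (rule L2_tendsto_integral_mult[OF L2_comb(2) L2_comb(2) L2(2,4) Sc(2) Td(2)])
    then show "(\<lambda>n. \<integral>\<omega>. (\<Sum>x\<in>S n. c n x * u x \<omega>) * (\<Sum>x\<in>T n. d n x * u x \<omega>) \<partial>M) \<longlonglongrightarrow> (\<integral>\<omega>. Y' \<omega> * X' \<omega> \<partial>M)"
      by (simp add: expand L2_u L2_u' cov)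
  qed
qed

text \<open>Everything in the closed span of a centered Gaussian field is centered Gaussian. The
  characteristic function expresses this uniformly in the degenerate and nondegenerate cases, and
  passes to limits because \<open>E exp (iY)\<close> and \<open>E Y\<^sup>2\<close> are continuous in \<open>L\<^sup>2\<close>.\<close>

lemma coupled_char:
  assumes G: "gaussian_field M u" and mean: "\<And>x. (\<integral>\<omega>. u x \<omega> \<partial>M) = 0" and Y: "coupled M u u' Y Y'"
  shows "(CLINT \<omega>|M. iexp (Y \<omega>)) = exp (- (\<integral>\<omega>. (Y \<omega>)\<^sup>2 \<partial>M) / 2)"
proof -
  obtain S c where S: "\<And>n::nat. finite (S n)"
    and lim: "L2_tendsto M (\<lambda>n \<omega>. \<Sum>x\<in>S n. c n x * u x \<omega>) Y sequentially"
    by (rule coupled_sequence[OF Y]) (rule that)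
  define X where "X n \<omega> = (\<Sum>x\<in>S n. c n x * u x \<omega>)" for n \<omega>
  have L2: "L2 M (X n)" "L2 M Y" for n
    using L2_comb Y by (auto simp: X_def[abs_def] coupled_def)
  have lim: "L2_tendsto M X Y sequentially"
    using lim by (simp add: X_def[abs_def])
  have "(\<integral>\<omega>. X n \<omega> \<partial>M) = 0" for n
    unfolding X_def using L2_integrable[OF L2_u] mean by (simp add: Bochner_Integration.integral_sum)
  moreover have "gaussian_rv M (X n)" for n
    using G S[of n] by (simp add: gaussian_field_def X_def[abs_def])
  ultimately have char: "(CLINT \<omega>|M. iexp (X n \<omega>)) = exp (- (\<integral>\<omega>. (X n \<omega>)\<^sup>2 \<partial>M) / 2)" for n
    using centered_gaussian_rv(2) by simp
  have "(\<lambda>n. CLINT \<omega>|M. iexp (X n \<omega>)) \<longlonglongrightarrow> (CLINT \<omega>|M. iexp (Y \<omega>))"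
    by (rule tendsto_integral_iexp[OF L2 lim])
  moreover have "(\<lambda>n. \<integral>\<omega>. (X n \<omega>)\<^sup>2 \<partial>M) \<longlonglongrightarrow> (\<integral>\<omega>. (Y \<omega>)\<^sup>2 \<partial>M)"
    using L2_tendsto_integral_mult[OF L2(1) L2(1) L2(2) L2(2) lim lim] by (simp add: power2_eq_square)
  then have "(\<lambda>n. complex_of_real (exp (- (\<integral>\<omega>. (X n \<omega>)\<^sup>2 \<partial>M) / 2))) \<longlonglongrightarrow> exp (- (\<integral>\<omega>. (Y \<omega>)\<^sup>2 \<partial>M) / 2)"
    by (intro tendsto_of_real tendsto_exp tendsto_divide tendsto_minus tendsto_const) auto
  ultimately show ?thesis
    unfolding char using LIMSEQ_unique by blast
qed

end

context L2_fields
begin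

lemma coupled_ms_deriv:
  fixes Z Z' :: "'q :: real_normed_vector \<Rightarrow> 'a \<Rightarrow> real"
  assumes Z: "\<And>x. coupled M u u' (Z x) (Z' x)"
    and deriv: "has_ms_deriv M Z v x Y" "has_ms_deriv M Z' v x Y'"
  shows "coupled M u u' Y Y'"
proof -
  have L2: "L2 M (Z x)" "L2 M (Z' x)" for x
    using Z by (auto simp: coupled_def)
  show ?thesis
  proof (rule coupled_limit[where F = "at (0 :: real)"
        and X = "\<lambda>t \<omega>. (Z (x + t *\<^sub>R v) \<omega> - Z x \<omega>) / t"
        and X' = "\<lambda>t \<omega>. (Z' (x + t *\<^sub>R v) \<omega> - Z' x \<omega>) / t"])
    show "coupled M u u' (\<lambda>\<omega>. (Z (x + t *\<^sub>R v) \<omega> - Z x \<omega>) / t) (\<lambda>\<omega>. (Z' (x + t *\<^sub>R v) \<omega> - Z' x \<omega>) / t)" for t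
      using coupled_scale[OF coupled_diff[OF Z Z], of "1 / t"] by simp
  qed (use deriv in \<open>simp_all add: has_ms_deriv_iff_L2 L2\<close>)
qed

text \<open>In terms of the isometry \<open>T\<close> this says \<open>T Y = a Y\<close>; since \<open>T\<close> acts on the span of \<open>u\<close>, it is meaningful
  when \<open>u'\<close> arises from \<open>u\<close> by moving the points.\<close>

definition eigenvector :: "real \<Rightarrow> ('a \<Rightarrow> real) \<Rightarrow> bool" where
  "eigenvector a Y \<longleftrightarrow> coupled M u u' Y (\<lambda>\<omega>. a * Y \<omega>)"

lemma eigenvector_imp_L2: "eigenvector a Y \<Longrightarrow> L2 M Y"
  by (simp add: eigenvector_def coupled_def)

lemma eigenvector_scale: "eigenvector a Y \<Longrightarrow> eigenvector a (\<lambda>\<omega>. c * Y \<omega>)"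
  using coupled_scale[of Y "\<lambda>\<omega>. a * Y \<omega>" c] by (simp add: eigenvector_def mult.left_commute)

lemma eigenvector_add: "eigenvector a Y \<Longrightarrow> eigenvector a X \<Longrightarrow> eigenvector a (\<lambda>\<omega>. Y \<omega> + X \<omega>)"
  using coupled_add[of Y "\<lambda>\<omega>. a * Y \<omega>" X "\<lambda>\<omega>. a * X \<omega>"] by (simp add: eigenvector_def distrib_left)

lemma eigenvector_diff: "eigenvector a Y \<Longrightarrow> eigenvector a X \<Longrightarrow> eigenvector a (\<lambda>\<omega>. Y \<omega> - X \<omega>)"
  using eigenvector_add[OF _ eigenvector_scale, of a Y X "-1"] by simp

lemma eigenvector_sum: "(\<And>i. i \<in> I \<Longrightarrow> eigenvector a (Y i)) \<Longrightarrow> eigenvector a (\<lambda>\<omega>. \<Sum>i\<in>I. Y i \<omega>)"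
  using coupled_sum[of I Y "\<lambda>i \<omega>. a * Y i \<omega>"] by (simp add: eigenvector_def sum_distrib_left)

lemma eigenvector_cong_AE:
  assumes "eigenvector a Y" "L2 M X" "AE \<omega> in M. Y \<omega> = X \<omega>"
  shows "eigenvector a X"
  using assms unfolding eigenvector_def by (intro coupled_cong_AE[where X = X]) (auto intro: L2_scale)

lemma eigenvector_inner_vec:
  fixes X :: "'a \<Rightarrow> real ^ 'n"
  assumes "\<And>i. eigenvector a (\<lambda>\<omega>. X \<omega> $ i)"
  shows "eigenvector a (\<lambda>\<omega>. s \<bullet> X \<omega>)"
  unfolding inner_vec_def using assms by (auto intro!: eigenvector_sum eigenvector_scale)

lemma eigenvector_inner_matrix:
  fixes X :: "'a \<Rightarrow> real ^ 'n ^ 'm"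
  assumes "\<And>i j. eigenvector a (\<lambda>\<omega>. X \<omega> $ i $ j)"
  shows "eigenvector a (\<lambda>\<omega>. s \<bullet> X \<omega>)"
  unfolding inner_vec_def using assms by (auto intro!: eigenvector_sum eigenvector_scale)

lemma eigenvector_inner_Pair:
  assumes "\<And>s. eigenvector a (\<lambda>\<omega>. s \<bullet> X \<omega>)" "\<And>s. eigenvector a (\<lambda>\<omega>. s \<bullet> Y \<omega>)"
  shows "eigenvector a (\<lambda>\<omega>. s \<bullet> (X \<omega>, Y \<omega>))"
  unfolding inner_prod_def using assms by (auto intro!: eigenvector_add)

text \<open>Eigenvectors \<open>A\<close>, \<open>B\<close> of an isometry satisfy \<open>E (A B) = a b E (A B)\<close>, so they are orthogonal when
  \<open>a * b \<noteq> 1\<close>. Then variances add, and the Gaussian characteristic functions factorize.\<close>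

theorem indep_rv2_if_eigenvalues:
  fixes X :: "'a \<Rightarrow> 'b :: euclidean_space" and Y :: "'a \<Rightarrow> 'c :: euclidean_space"
  assumes G: "gaussian_field M u" and mean: "\<And>x. (\<integral>\<omega>. u x \<omega> \<partial>M) = 0"
    and cov: "\<And>x y. (\<integral>\<omega>. u x \<omega> * u y \<omega> \<partial>M) = (\<integral>\<omega>. u' x \<omega> * u' y \<omega> \<partial>M)"
    and X: "\<And>s. eigenvector a (\<lambda>\<omega>. s \<bullet> X \<omega>)" and Y: "\<And>t. eigenvector b (\<lambda>\<omega>. t \<bullet> Y \<omega>)"
    and "a * b \<noteq> 1"
  shows "indep_rv2 M X Y"
proof (rule indep_rv2_if_char_factorizes)
  show "X \<in> borel_measurable M"
    using L2_measurable[OF eigenvector_imp_L2[OF X]]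
    by (simp add: borel_measurable_euclidean_space[of X] inner_commute[of "X _"])
  show "Y \<in> borel_measurable M"
    using L2_measurable[OF eigenvector_imp_L2[OF Y]]
    by (simp add: borel_measurable_euclidean_space[of Y] inner_commute[of "Y _"])
  fix s t
  define A where "A \<omega> = s \<bullet> X \<omega>" for \<omega>
  define B where "B \<omega> = t \<bullet> Y \<omega>" for \<omega>
  have A: "coupled M u u' A (\<lambda>\<omega>. a * A \<omega>)" and B: "coupled M u u' B (\<lambda>\<omega>. b * B \<omega>)"
    using X[of s] Y[of t] by (auto simp: eigenvector_def A_def[abs_def] B_def[abs_def])
  have L2: "L2 M A" "L2 M B"
    using A B by (auto simp: coupled_def)
  have "(\<integral>\<omega>. A \<omega> * B \<omega> \<partial>M) = (\<integral>\<omega>. (a * b) * (A \<omega> * B \<omega>) \<partial>M)"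
    using coupled_integral_mult[OF cov A B] by (simp add: mult_ac)
  then have "(\<integral>\<omega>. A \<omega> * B \<omega> \<partial>M) = (a * b) * (\<integral>\<omega>. A \<omega> * B \<omega> \<partial>M)"
    by simp
  with \<open>a * b \<noteq> 1\<close> have orth: "(\<integral>\<omega>. A \<omega> * B \<omega> \<partial>M) = 0"
    by (metis mult_cancel_right1)
  have "(\<integral>\<omega>. (A \<omega> + B \<omega>)\<^sup>2 \<partial>M) = (\<integral>\<omega>. (A \<omega>)\<^sup>2 + 2 * (A \<omega> * B \<omega>) + (B \<omega>)\<^sup>2 \<partial>M)"
    by (simp add: power2_sum mult.assoc add_ac)
  also have "\<dots> = (\<integral>\<omega>. (A \<omega>)\<^sup>2 \<partial>M) + (\<integral>\<omega>. (B \<omega>)\<^sup>2 \<partial>M)"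
    using L2_integrable_mult[OF L2] L2_integrable_square[OF L2(1)] L2_integrable_square[OF L2(2)]
    by (simp add: orth)
  finally have var: "(\<integral>\<omega>. (A \<omega> + B \<omega>)\<^sup>2 \<partial>M) = (\<integral>\<omega>. (A \<omega>)\<^sup>2 \<partial>M) + (\<integral>\<omega>. (B \<omega>)\<^sup>2 \<partial>M)" .
  have "(CLINT \<omega>|M. iexp (A \<omega> + B \<omega>)) = (CLINT \<omega>|M. iexp (A \<omega>)) * (CLINT \<omega>|M. iexp (B \<omega>))"
    unfolding coupled_char[OF G mean A] coupled_char[OF G mean B]
      coupled_char[OF G mean coupled_add[OF A B]] var of_real_mult[symmetric] exp_add[symmetric]
    by (simp add: diff_divide_distrib)
  then show "(CLINT \<omega>|M. iexp (s \<bullet> X \<omega> + t \<bullet> Y \<omega>))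
      = (CLINT \<omega>|M. iexp (s \<bullet> X \<omega>)) * (CLINT \<omega>|M. iexp (t \<bullet> Y \<omega>))"
    by (simp only: A_def B_def)
qed

end

section \<open>Derivatives of a block isotropic field\<close>

text \<open>If \<open>R\<close> reverses or keeps the direction \<open>v\<close>, the derivative of \<open>u (R x)\<close> along \<open>v\<close> is \<open>\<sigma>\<close> times that of \<open>u\<close>
  at \<open>R x\<close>. The first derivatives have to be coupled at all points \<open>x\<close>, where \<open>R\<close> moves them, before
  differentiating again; only at the fixed point \<open>z\<close> do they become eigenvectors.\<close>

lemma eigenvector_ms_deriv_reflection:
  fixes u :: "'p :: real_normed_vector \<Rightarrow> 'a \<Rightarrow> real"
  assumes "prob_space M" and L2: "\<And>x. L2 M (u x)"
    and U: "\<And>v x. has_ms_deriv M u v x (U v x)"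
    and U2: "\<And>v w x. has_ms_deriv M (U v) w x (U2 v w x)"
    and fixpoint: "R z = z"
    and v: "\<And>x t. R (x + t *\<^sub>R v) = R x + t *\<^sub>R (\<sigma> *\<^sub>R v)" "\<sigma> = 1 \<or> \<sigma> = - 1"
    and w: "\<And>x t. R (x + t *\<^sub>R w) = R x + t *\<^sub>R (\<tau> *\<^sub>R w)" "\<tau> = 1 \<or> \<tau> = - 1"
  shows "L2_fields.eigenvector M u (\<lambda>x. u (R x)) \<sigma> (U v z)"
    and "L2_fields.eigenvector M u (\<lambda>x. u (R x)) (\<sigma> * \<tau>) (U2 v w z)"
proof -
  interpret prob_space M by fact
  interpret L2_fields M u "\<lambda>x. u (R x)"
    by unfold_locales (rule L2)+
  have signed: "has_ms_deriv M (\<lambda>x. Z (R x)) d x (\<lambda>\<omega>. \<epsilon> * Y \<omega>)"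
    if Z: "\<And>x. L2 M (Z x)" and d: "\<And>x t. R (x + t *\<^sub>R d) = R x + t *\<^sub>R (\<epsilon> *\<^sub>R d)" "\<epsilon> = 1 \<or> \<epsilon> = - 1"
      and Y: "has_ms_deriv M Z d (R x) Y" for Z d \<epsilon> x Y
  proof (rule has_ms_deriv_compose[where w = "\<epsilon> *\<^sub>R d"])
    show "has_ms_deriv M Z (\<epsilon> *\<^sub>R d) (R x) (\<lambda>\<omega>. \<epsilon> * Y \<omega>)"
      using d(2) Y has_ms_deriv_uminus_direction[OF Z Y] by auto
  qed (rule d(1))
  have first: "coupled M u (\<lambda>x. u (R x)) (U v x) (\<lambda>\<omega>. \<sigma> * U v (R x) \<omega>)" for x
    by (rule coupled_ms_deriv[OF coupled_base U signed[OF L2 v U]])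
  then show "eigenvector \<sigma> (U v z)"
    unfolding eigenvector_def using fixpoint by metis
  have L2_U: "L2 M (U v x)" for x
    using U by (rule has_ms_deriv_imp_L2)
  have "has_ms_deriv M (\<lambda>x \<omega>. \<sigma> * U v (R x) \<omega>) w z (\<lambda>\<omega>. \<sigma> * (\<tau> * U2 v w (R z) \<omega>))"
    by (intro has_ms_deriv_scale signed L2_U w U2)
  from coupled_ms_deriv[OF first U2 this] show "eigenvector (\<sigma> * \<tau>) (U2 v w z)"
    by (simp add: eigenvector_def fixpoint mult.assoc)
qed

text \<open>The shape of \<open>block_field u\<close> and of its first derivatives; the flip acts on the direction as well as
  on the point.\<close>

lemma has_ms_deriv_antisymmetrized:
  fixes Z W :: "'p :: real_normed_vector \<times> 'p \<Rightarrow> 'a \<Rightarrow> real"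
  assumes "\<And>x. L2 M (Z x)" "\<And>x. L2 M (W x)"
    and "has_ms_deriv M Z v x Y" "has_ms_deriv M W (prod.swap v) (prod.swap x) X"
  shows "has_ms_deriv M (\<lambda>x \<omega>. Z x \<omega> - W (prod.swap x) \<omega>) v x (\<lambda>\<omega>. Y \<omega> - X \<omega>)"
  using assms by (intro has_ms_deriv_diff has_ms_deriv_compose[where R = prod.swap and w = "prod.swap v"])
    (auto simp: prod_eq_iff)

theorem theorem22:
  fixes M :: "'a measure"
    and u :: "(real ^ 'n) \<times> (real ^ 'n) \<Rightarrow> 'a \<Rightarrow> real"
    and h :: "real \<Rightarrow> real"
    and zs :: "real ^ 'n"
  assumes "prob_space M"
    and "isotropic_gaussian_field M h u"
    and "Ck 4 (\<lambda>(x, y). cov_fun M u x y)"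
    and "C2_half_line h"
  shows "(\<exists>g H11 H12. block_derivatives M (block_field u) (zs, zs) g H11 H12) \<and>
    (\<forall>g H11 H12. block_derivatives M (block_field u) (zs, zs) g H11 H12 \<longrightarrow>
       indep_rv3 M g H11 H12 \<and>
       indep_rv2 M g H11 \<and> indep_rv2 M g H12 \<and> indep_rv2 M H11 H12)"
proof -
  interpret prob_space M by fact
  have G: "gaussian_field M u" and mean: "\<And>x. (\<integral>\<omega>. u x \<omega> \<partial>M) = 0"
    and iso: "\<And>x y. cov_fun M u x y = h ((norm (x - y))\<^sup>2)"
    using assms(2) by (auto simp: isotropic_gaussian_field_def)
  have L2_u: "L2 M (u x)" for x
  proof (rule centered_gaussian_rv(1)[OF _ mean])
    show "gaussian_rv M (u x)"
      using G[unfolded gaussian_field_def, rule_format, of "{x}" "\<lambda>_. 1"] by simp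
  qed
  have cov_fun: "cov_fun M u x y = (\<integral>\<omega>. u x \<omega> * u y \<omega> \<partial>M)" for x y
    by (simp add: cov_fun_def mean)
  have "Ck (Suc (Suc (Suc (Suc 0)))) (\<lambda>(x, y). \<integral>\<omega>. u x \<omega> * u y \<omega> \<partial>M)"
  proof -
    have "(4 :: nat) = Suc (Suc (Suc (Suc 0)))" by simp
    then show ?thesis
      using assms(3) by (simp only: cov_fun)
  qed
  from ms_deriv_exists[OF L2_u this] have "\<exists>U. \<forall>v. (\<forall>x. has_ms_deriv M u v x (U v x)) \<and>
      Ck (Suc (Suc 0)) (\<lambda>(x, y). \<integral>\<omega>. U v x \<omega> * U v y \<omega> \<partial>M)"
    by (intro choice allI)
  then obtain U where U: "\<And>v x. has_ms_deriv M u v x (U v x)"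
    and CkU: "\<And>v. Ck (Suc (Suc 0)) (\<lambda>(x, y). \<integral>\<omega>. U v x \<omega> * U v y \<omega> \<partial>M)"
    by blast
  have L2_U: "L2 M (U v x)" for v x
    using U by (rule has_ms_deriv_imp_L2)
  have "\<exists>Y. has_ms_deriv M (U v) w x Y" for v w x
    using ms_deriv_exists[OF L2_U CkU, of v w] by blast
  then have "\<exists>U2. \<forall>v w x. has_ms_deriv M (U v) w x (U2 v w x)"
    by (intro choice allI)
  then obtain U2 where U2: "\<And>v w x. has_ms_deriv M (U v) w x (U2 v w x)"
    by blast
  define z where "z = (zs, zs)"
  define e1 :: "'n \<Rightarrow> (real ^ 'n) \<times> (real ^ 'n)" where "e1 i = (axis i 1, 0)" for i
  define e2 :: "'n \<Rightarrow> (real ^ 'n) \<times> (real ^ 'n)" where "e2 i = (0, axis i 1)" for i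
  have [simp]: "prod.swap z = z" "prod.swap (e1 i) = e2 i" "prod.swap (e2 i) = e1 i" for i
    by (simp_all add: z_def e1_def e2_def)
  let ?f = "block_field u"
  \<comment> \<open>U2 v w differentiates along v first and along w second, so for the entry i j the direction of j comes first.\<close>
  define G1 where "G1 j x \<omega> = U (e1 j) x \<omega> - U (e2 j) (prod.swap x) \<omega>" for j x \<omega>
  define G2 where "G2 j x \<omega> = U (e2 j) x \<omega> - U (e1 j) (prod.swap x) \<omega>" for j x \<omega>
  define K11 where "K11 i j \<omega> = U2 (e1 j) (e1 i) z \<omega> - U2 (e2 j) (e2 i) z \<omega>" for i j \<omega>
  define K12 where "K12 i j \<omega> = U2 (e2 j) (e1 i) z \<omega> - U2 (e1 j) (e2 i) z \<omega>" for i j \<omega>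
  have f_eq: "?f = (\<lambda>x \<omega>. u x \<omega> - u (prod.swap x) \<omega>)"
    by (simp add: fun_eq_iff block_field_def)
  have L2_f: "L2 M (?f x)" for x
    unfolding f_eq by (intro L2_diff L2_u)
  have L2_G: "L2 M (G1 j x)" "L2 M (G2 j x)" for j x
    unfolding G1_def[abs_def] G2_def[abs_def] by (intro L2_diff L2_U)+
  have G1: "has_ms_deriv M ?f (e1 j) x (G1 j x)" and G2: "has_ms_deriv M ?f (e2 j) x (G2 j x)" for j x
    unfolding f_eq G1_def[abs_def] G2_def[abs_def]
    by (auto intro!: has_ms_deriv_antisymmetrized L2_u U)
  have K11: "has_ms_deriv M (G1 j) (e1 i) z (K11 i j)" and K12: "has_ms_deriv M (G2 j) (e1 i) z (K12 i j)" for i j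
    unfolding G1_def[abs_def] G2_def[abs_def] K11_def[abs_def] K12_def[abs_def]
    by (auto intro!: has_ms_deriv_antisymmetrized L2_U U2)
  have "block_derivatives M ?f z (\<lambda>\<omega>. \<chi> i. G1 i z \<omega>) (\<lambda>\<omega>. \<chi> i j. K11 i j \<omega>) (\<lambda>\<omega>. \<chi> i j. K12 i j \<omega>)"
    unfolding block_derivatives_def e1_def[symmetric] e2_def[symmetric]
    by (intro exI[of _ G1] exI[of _ G2]) (auto simp: G1 G2 K11 K12)
  moreover have "indep_rv3 M g H11 H12 \<and> indep_rv2 M g H11 \<and> indep_rv2 M g H12 \<and> indep_rv2 M H11 H12"
    if deriv: "block_derivatives M ?f z g H11 H12" for g H11 H12
  proof -
    obtain F1 F2 where F1: "\<And>j x. has_ms_deriv M ?f (e1 j) x (F1 j x)"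
      and F2: "\<And>j x. has_ms_deriv M ?f (e2 j) x (F2 j x)"
      and g: "\<And>i. has_ms_deriv M ?f (e1 i) z (\<lambda>\<omega>. g \<omega> $ i)"
      and H11: "\<And>i j. has_ms_deriv M (F1 j) (e1 i) z (\<lambda>\<omega>. H11 \<omega> $ i $ j)"
      and H12: "\<And>i j. has_ms_deriv M (F2 j) (e1 i) z (\<lambda>\<omega>. H12 \<omega> $ i $ j)"
      using deriv unfolding block_derivatives_def e1_def[symmetric] e2_def[symmetric] by blast
    have AE_g: "AE \<omega> in M. G1 i z \<omega> = g \<omega> $ i" for i
      by (rule has_ms_deriv_unique[OF L2_f G1 g])
    have AE_H11: "AE \<omega> in M. K11 i j \<omega> = H11 \<omega> $ i $ j" for i j
      by (rule has_ms_deriv_unique[OF L2_G(1) K11 has_ms_deriv_cong_AE[OF has_ms_deriv_unique[OF L2_f F1 G1] H11]])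
    have AE_H12: "AE \<omega> in M. K12 i j \<omega> = H12 \<omega> $ i $ j" for i j
      by (rule has_ms_deriv_unique[OF L2_G(2) K12 has_ms_deriv_cong_AE[OF has_ms_deriv_unique[OF L2_f F2 G2] H12]])
    note L2 = has_ms_deriv_imp_L2[OF g] has_ms_deriv_imp_L2[OF H11] has_ms_deriv_imp_L2[OF H12]
    define R where "R \<sigma> \<tau> x = z + (\<sigma> *\<^sub>R fst (x - z), \<tau> *\<^sub>R snd (x - z))" for \<sigma> \<tau> :: real and x
    have R_z: "R \<sigma> \<tau> z = z" for \<sigma> \<tau>
      by (simp add: R_def zero_prod_def[symmetric])
    have R_e1: "R \<sigma> \<tau> (x + t *\<^sub>R e1 i) = R \<sigma> \<tau> x + t *\<^sub>R (\<sigma> *\<^sub>R e1 i)"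
      and R_e2: "R \<sigma> \<tau> (x + t *\<^sub>R e2 i) = R \<sigma> \<tau> x + t *\<^sub>R (\<tau> *\<^sub>R e2 i)" for \<sigma> \<tau> x t i
      by (simp_all add: R_def e1_def e2_def prod_eq_iff algebra_simps)
    have isometry: "norm (R \<sigma> \<tau> x - R \<sigma> \<tau> y) = norm (x - y)"
      if "\<sigma> = 1 \<or> \<sigma> = - 1" "\<tau> = 1 \<or> \<tau> = - 1" for \<sigma> \<tau> x y
    proof -
      have "R \<sigma> \<tau> x - R \<sigma> \<tau> y = (\<sigma> *\<^sub>R fst (x - y), \<tau> *\<^sub>R snd (x - y))"
        by (simp add: R_def prod_eq_iff algebra_simps)
      then show ?thesis
        using that by (auto simp: norm_prod_def norm_minus_commute)
    qed
    have cov: "(\<integral>\<omega>. u x \<omega> * u y \<omega> \<partial>M) = (\<integral>\<omega>. u (R \<sigma> \<tau> x) \<omega> * u (R \<sigma> \<tau> y) \<omega> \<partial>M)"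
      if "\<sigma> = 1 \<or> \<sigma> = - 1" "\<tau> = 1 \<or> \<tau> = - 1" for \<sigma> \<tau> x y
      using iso[of x y] iso[of "R \<sigma> \<tau> x" "R \<sigma> \<tau> y"] isometry[OF that] by (simp add: cov_fun)
    note reflection = eigenvector_ms_deriv_reflection[where M = M and u = u and U = U and ?U2.0 = U2 and z = z,
        OF \<open>prob_space M\<close> L2_u U U2]
    \<comment> \<open>The reflection at z separates the odd derivative g from the even derivatives H11 and H12.\<close>
    interpret point_reflection: L2_fields M u "\<lambda>x. u (R (- 1) (- 1) x)"
      by unfold_locales (rule L2_u)+
    have point_g: "point_reflection.eigenvector (- 1) (\<lambda>\<omega>. g \<omega> $ i)" for i
      by (rule point_reflection.eigenvector_cong_AE[OF _ L2(1) AE_g], unfold G1_def[abs_def])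
        (auto intro!: point_reflection.eigenvector_diff reflection(1) R_z R_e1 R_e2)
    have point_H11: "point_reflection.eigenvector (- 1 * - 1) (\<lambda>\<omega>. H11 \<omega> $ i $ j)" for i j
      by (rule point_reflection.eigenvector_cong_AE[OF _ L2(2) AE_H11], unfold K11_def[abs_def])
        (intro point_reflection.eigenvector_diff reflection(2) R_z R_e1 R_e2 disjI2 refl)
    have point_H12: "point_reflection.eigenvector (- 1 * - 1) (\<lambda>\<omega>. H12 \<omega> $ i $ j)" for i j
      by (rule point_reflection.eigenvector_cong_AE[OF _ L2(3) AE_H12], unfold K12_def[abs_def])
        (intro point_reflection.eigenvector_diff reflection(2) R_z R_e1 R_e2 disjI2 refl)
    have "indep_rv2 M g (\<lambda>\<omega>. (H11 \<omega>, H12 \<omega>))"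
      by (rule point_reflection.indep_rv2_if_eigenvalues[OF G mean cov, where a = "- 1" and b = 1])
        (auto intro!: point_reflection.eigenvector_inner_Pair point_reflection.eigenvector_inner_vec point_reflection.eigenvector_inner_matrix
          point_g point_H11[simplified] point_H12[simplified])
    \<comment> \<open>The reflection of the second block separates H11 from H12.\<close>
    interpret block_reflection: L2_fields M u "\<lambda>x. u (R 1 (- 1) x)"
      by unfold_locales (rule L2_u)+
    have block_H11: "block_reflection.eigenvector 1 (\<lambda>\<omega>. H11 \<omega> $ i $ j)" for i j
    proof (rule block_reflection.eigenvector_cong_AE[OF _ L2(2) AE_H11], unfold K11_def[abs_def], rule block_reflection.eigenvector_diff)
      show "block_reflection.eigenvector 1 (U2 (e1 j) (e1 i) z)"
        using reflection(2)[where R = "R 1 (- 1)" and v = "e1 j" and w = "e1 i" and \<sigma> = "1" and \<tau> = "1"] R_z R_e1 by simp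
      show "block_reflection.eigenvector 1 (U2 (e2 j) (e2 i) z)"
        using reflection(2)[where R = "R 1 (- 1)" and v = "e2 j" and w = "e2 i" and \<sigma> = "- 1" and \<tau> = "- 1"] R_z R_e2 by simp
    qed
    have block_H12: "block_reflection.eigenvector (- 1) (\<lambda>\<omega>. H12 \<omega> $ i $ j)" for i j
    proof (rule block_reflection.eigenvector_cong_AE[OF _ L2(3) AE_H12], unfold K12_def[abs_def], rule block_reflection.eigenvector_diff)
      show "block_reflection.eigenvector (- 1) (U2 (e2 j) (e1 i) z)"
        using reflection(2)[where R = "R 1 (- 1)" and v = "e2 j" and w = "e1 i" and \<sigma> = "- 1" and \<tau> = "1"] R_z R_e1 R_e2 by simp
      show "block_reflection.eigenvector (- 1) (U2 (e1 j) (e2 i) z)"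
        using reflection(2)[where R = "R 1 (- 1)" and v = "e1 j" and w = "e2 i" and \<sigma> = "1" and \<tau> = "- 1"] R_z R_e1 R_e2 by simp
    qed
    have "indep_rv2 M H11 H12"
      by (rule block_reflection.indep_rv2_if_eigenvalues[OF G mean cov, where a = 1 and b = "- 1"])
        (auto intro!: block_reflection.eigenvector_inner_matrix block_H11 block_H12)
    with \<open>indep_rv2 M g (\<lambda>\<omega>. (H11 \<omega>, H12 \<omega>))\<close> show ?thesis
      using indep_rv3_if_indep_rv2 by blast
  qed
  ultimately show ?thesis
    unfolding z_def by blast
qed

end
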